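(* Let $n\ge 2$ and $m\ge 1$ be integers, let $u_0<u_1<\cdots<u_m<u_{m+1}=+\infty$ with $u_0,\dots,u_m$ real, let $a_i>0$, $k_i>0$ for $i=0,\dots,m$, $d_i\ge 0$ for $i=1,\dots,m$, and $A>0$. Then a self-similar radial solution (in the sense defined in the context) of the $n$-dimensional multi-phase Stefan problem with constant initial data $u(0,x)\equiv u_0$ and growth condition $u(t,x)\sim A\,\mathcal{E}_n(|x|/(a_m\sqrt t))$ as $x\to0$ is unique; that is, there is at most one tuple of real numbers $+\infty=\xi_0>\xi_1>\cdots>\xi_m>0$ such that the function $u(t,x)=v(|x|/\sqrt t)$, with $$v(\xi)=u_m+A\bigl(G(\xi/a_m)-G(\xi_m/a_m)\bigr),\quad 0<\xi<\xi_m,$$ $$v(\xi)=u_i+\frac{(u_{i+1}-u_i)\bigl(G(\xi/a_i)-G(\xi_i/a_i)\bigr)}{G(\xi_{i+1}/a_i)-G(\xi_i/a_i)},\quad \xi_{i+1}<\xi<\xi_i,\ i=0,\ldots,m-1,$$ solves this problem. In particular, the function $$E(\bar\xi)=-\sum_{i=0}^{m-1}k_i(u_{i+1}-u_i)\ln\bigl(G(\xi_{i+1}/a_i)-G(\xi_i/a_i)\bigr)+k_mA\,G(\xi_m/a_m)+\frac14\sum_{i=1}^m d_i\xi_i^2$$ (with $\xi_0=+\infty$), defined on $\Omega=\{\bar\xi=(\xi_1,\ldots,\xi_m)\in\mathbb{R}^m : \xi_1>\cdots>\xi_m>0\}$, has only one critical point, namely the point of its global minimum.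
   Context: $G(y)=\int_y^{+\infty}s^{1-n}e^{-s^2/4}\,ds$ for $y>0$, with $G(+\infty)=0$. For $y>0$, $\mathcal{E}_n(y)=\frac{1}{(n-2)y^{n-2}}$ if $n\ge3$ and $\mathcal{E}_2(y)=-\ln y$. The Stefan problem is posed in the half-space $\{(t,x): t>0,\ x\in\mathbb{R}^n\}$ (for $x\neq 0$): (i) $u_t=a_i^2\Delta u$ in the regions where $u_i<u<u_{i+1}$, $i=0,\ldots,m$; (ii) on the (unknown) phase transition hypersurface where $u=u_i$, $i=1,\dots,m$, the Stefan condition $-d_i\nu_t+(k_i\nabla_xu_+-k_{i-1}\nabla_xu_-)\cdot\nu_x=0$ holds, where $\nu=(\nu_t,\nu_x)\in\mathbb{R}\times\mathbb{R}^n$, $\nu\ne0$, is a normal vector to the hypersurface directed from the $(i-1)$-th phase ($u_{i-1}<u<u_i$) to the $i$-th phase ($u_i<u<u_{i+1}$), and $\nabla_xu_-$, $\nabla_xu_+$ are the one-sided limits of $\nabla_xu$ from the colder and the warmer side respectively; (iii) $u(0,x)=u_0$ (as limit when $t\to0+$, $x\ne0$); (iv) $u(t,x)\sim A\,\mathcal{E}_n(|x|/(a_m\sqrt t))$ as $x\to0$. A self-similar radial solution here is a function $u(t,x)=v(|x|/\sqrt t)$ of the form displayed in the claim (extended continuously by $v(\xi_i)=u_i$), whose phase transition surfaces are $|x|=\xi_i\sqrt t$, $i=1,\dots,m$, satisfying (i)–(iv). For a function of this form, (i), (iii), (iv) hold automatically, and (ii) is equivalent to $$\frac{d_i\xi_i}{2}+k_iv'(\xi_i-0)-k_{i-1}v'(\xi_i+0)=0,\quad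 i=1,\ldots,m,$$ which is the system $\nabla E(\bar\xi)=0$. *)

theory Defs
  imports "HOL-Analysis.Analysis" "HOL-Library.Landau_Symbols"
begin

text \<open>
  Conventions. Levels \<open>lev 0 < \<dots> < lev m\<close> stand for \<open>u\<^sub>0 < \<dots> < u\<^sub>m\<close>; the level
  \<open>u\<^bsub>m+1\<^esub> = +\<infinity>\<close> and the radius \<open>\<xi>\<^sub>0 = +\<infinity>\<close> are not stored but handled by case
  distinction. A point of \<open>\<real>\<^sup>m\<close> is a function on \<open>{1..m}\<close> (extensional outside), and
  the values of the parameter sequences at other indices never matter.
\<close>

definition G :: "nat \<Rightarrow> real \<Rightarrow> real" where
  "G n y = (LBINT s:{y..}. s powi (1 - int n) * exp (- s\<^sup>2 / 4))"

definition fund :: "nat \<Rightarrow> real \<Rightarrow> real" where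
  "fund n y = (if n = 2 then - ln y else 1 / ((real n - 2) * y ^ (n - 2)))"

definition Omega :: "nat \<Rightarrow> (nat \<Rightarrow> real) set" where
  "Omega m = {\<xi> \<in> extensional {1..m}. (\<forall>i\<in>{1..<m}. \<xi> (Suc i) < \<xi> i) \<and> 0 < \<xi> m}"

text \<open>\<open>Gxi n c \<xi> i\<close> is \<open>G(\<xi>\<^sub>i/c)\<close>, with \<open>G(\<xi>\<^sub>0/c) = G(+\<infinity>) = 0\<close>.\<close>

definition Gxi :: "nat \<Rightarrow> real \<Rightarrow> (nat \<Rightarrow> real) \<Rightarrow> nat \<Rightarrow> real" where
  "Gxi n c \<xi> i = (if i = 0 then 0 else G n (\<xi> i / c))"


subsection \<open>The Stefan problem\<close>

definition phase :: "nat \<Rightarrow> (nat \<Rightarrow> real) \<Rightarrow> (real \<Rightarrow> real^'n \<Rightarrow> real) \<Rightarrow> nat \<Rightarrow> (real \<times> (real^'n)) set" where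
  "phase m lev u i =
     {(t, x). 0 < t \<and> x \<noteq> 0 \<and> lev i < u t x \<and> (i < m \<longrightarrow> u t x < lev (Suc i))}"

definition interface :: "(nat \<Rightarrow> real) \<Rightarrow> (real \<Rightarrow> real^'n \<Rightarrow> real) \<Rightarrow> nat \<Rightarrow> (real \<times> (real^'n)) set" where
  "interface lev u i = {(t, x). 0 < t \<and> x \<noteq> 0 \<and> u t x = lev i}"

definition has_laplacian :: "(real^'n \<Rightarrow> real) \<Rightarrow> real \<Rightarrow> real^'n \<Rightarrow> bool" where
  "has_laplacian f L x \<longleftrightarrow>
     (\<exists>g h. (\<forall>j. (\<forall>\<^sub>F y in nhds x.
                    ((\<lambda>s. f (y + s *\<^sub>R axis j 1)) has_real_derivative g j y) (at 0)) \<and>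
                 ((\<lambda>s. g j (x + s *\<^sub>R axis j 1)) has_real_derivative h j) (at 0)) \<and>
            L = (\<Sum>j\<in>UNIV. h j))"

definition heat_eq_at :: "real \<Rightarrow> (real \<Rightarrow> real^'n \<Rightarrow> real) \<Rightarrow> real \<Rightarrow> real^'n \<Rightarrow> bool" where
  "heat_eq_at a u t x \<longleftrightarrow>
     (\<exists>D L. ((\<lambda>s. u s x) has_real_derivative D) (at t) \<and> has_laplacian (u t) L x \<and> D = a\<^sup>2 * L)"

text \<open>
  \<open>\<nu>\<close> is a normal at \<open>P\<close> to the hypersurface \<open>S\<close>, directed from \<open>N\<close> (negative side) to
  \<open>Q\<close> (positive side): near \<open>P\<close>, these three sets are the zero, negativity and positivity
  sets of a \<open>C\<^sup>1\<close> function whose gradient at \<open>P\<close> is \<open>\<nu> \<noteq> 0\<close>.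
\<close>

definition normal_from_to ::
  "'b::euclidean_space set \<Rightarrow> 'b set \<Rightarrow> 'b set \<Rightarrow> 'b \<Rightarrow> 'b \<Rightarrow> bool" where
  "normal_from_to S N Q P \<nu> \<longleftrightarrow> \<nu> \<noteq> 0 \<and> P \<in> S \<and>
     (\<exists>W \<phi> D. open W \<and> P \<in> W \<and> continuous_on W D \<and> D P = \<nu> \<and>
        (\<forall>R\<in>W. (GDERIV \<phi> R :> D R) \<and> (\<phi> R = 0 \<longleftrightarrow> R \<in> S) \<and>
                (\<phi> R < 0 \<longleftrightarrow> R \<in> N) \<and> (\<phi> R > 0 \<longleftrightarrow> R \<in> Q)))"

text \<open>\<open>p\<close> is the limit at \<open>P\<close>, from inside the region \<open>Q\<close>, of the spatial gradient of \<open>u\<close>.\<close>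

definition grad_limit ::
  "(real \<Rightarrow> real^'n \<Rightarrow> real) \<Rightarrow> (real \<times> (real^'n)) set \<Rightarrow> real \<times> (real^'n) \<Rightarrow> real^'n \<Rightarrow> bool" where
  "grad_limit u Q P p \<longleftrightarrow>
     (\<exists>g. (\<forall>(t, x)\<in>Q. GDERIV (u t) x :> g (t, x)) \<and> (g \<longlongrightarrow> p) (at P within Q))"

definition stefan_condition ::
  "nat \<Rightarrow> (nat \<Rightarrow> real) \<Rightarrow> (nat \<Rightarrow> real) \<Rightarrow> (nat \<Rightarrow> real) \<Rightarrow> (real \<Rightarrow> real^'n \<Rightarrow> real) \<Rightarrow> nat \<Rightarrow> bool" where
  "stefan_condition m lev k d u i \<longleftrightarrow>
     (\<forall>P\<in>interface lev u i. \<exists>pplus pminus.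
        grad_limit u (phase m lev u i) P pplus \<and>
        grad_limit u (phase m lev u (i - 1)) P pminus \<and>
        (\<exists>\<nu>. normal_from_to (interface lev u i) (phase m lev u (i - 1)) (phase m lev u i) P \<nu>) \<and>
        (\<forall>\<nu>t \<nu>x. normal_from_to (interface lev u i) (phase m lev u (i - 1)) (phase m lev u i) P (\<nu>t, \<nu>x)
           \<longrightarrow> - d i * \<nu>t + (k i *\<^sub>R pplus - k (i - 1) *\<^sub>R pminus) \<bullet> \<nu>x = 0))"

definition stefan_solution ::
  "nat \<Rightarrow> (nat \<Rightarrow> real) \<Rightarrow> (nat \<Rightarrow> real) \<Rightarrow> (nat \<Rightarrow> real) \<Rightarrow> (nat \<Rightarrow> real) \<Rightarrow> real
     \<Rightarrow> (real \<Rightarrow> real^'n \<Rightarrow> real) \<Rightarrow> bool" where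
  "stefan_solution m lev a k d A u \<longleftrightarrow>
     (\<forall>i\<le>m. \<forall>(t, x)\<in>phase m lev u i. heat_eq_at (a i) u t x) \<and>
     (\<forall>i\<in>{1..m}. stefan_condition m lev k d u i) \<and>
     (\<forall>x. x \<noteq> 0 \<longrightarrow> ((\<lambda>t. u t x) \<longlongrightarrow> lev 0) (at_right 0)) \<and>
     (\<forall>t>0. u t \<sim>[at 0] (\<lambda>x. A * fund CARD('n) (norm x / (a m * sqrt t))))"


subsection \<open>Self-similar radial solutions\<close>

definition profile ::
  "nat \<Rightarrow> nat \<Rightarrow> (nat \<Rightarrow> real) \<Rightarrow> (nat \<Rightarrow> real) \<Rightarrow> real \<Rightarrow> (nat \<Rightarrow> real) \<Rightarrow> (real \<Rightarrow> real) \<Rightarrow> bool" where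
  "profile n m lev a A \<xi> v \<longleftrightarrow>
     (\<forall>s. 0 < s \<and> s < \<xi> m \<longrightarrow> v s = lev m + A * (G n (s / a m) - G n (\<xi> m / a m))) \<and>
     (\<forall>i<m. \<forall>s. \<xi> (Suc i) < s \<and> (0 < i \<longrightarrow> s < \<xi> i) \<longrightarrow>
        v s = lev i + (lev (Suc i) - lev i) * (G n (s / a i) - Gxi n (a i) \<xi> i)
                        / (Gxi n (a i) \<xi> (Suc i) - Gxi n (a i) \<xi> i)) \<and>
     (\<forall>i\<in>{1..m}. v (\<xi> i) = lev i)"

definition self_similar_solution ::
  "nat \<Rightarrow> (nat \<Rightarrow> real) \<Rightarrow> (nat \<Rightarrow> real) \<Rightarrow> (nat \<Rightarrow> real) \<Rightarrow> (nat \<Rightarrow> real) \<Rightarrow> real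
     \<Rightarrow> (nat \<Rightarrow> real) \<Rightarrow> (real \<Rightarrow> real^'n \<Rightarrow> real) \<Rightarrow> bool" where
  "self_similar_solution m lev a k d A \<xi> u \<longleftrightarrow> \<xi> \<in> Omega m \<and>
     (\<exists>v. profile CARD('n) m lev a A \<xi> v \<and>
          (\<forall>t x. 0 < t \<and> x \<noteq> 0 \<longrightarrow> u t x = v (norm x / sqrt t))) \<and>
     (\<forall>i\<in>{1..m}. interface lev u i = {(t, x). 0 < t \<and> norm x = \<xi> i * sqrt t}) \<and>
     stefan_solution m lev a k d A u"


subsection \<open>The function E\<close>

definition E ::
  "nat \<Rightarrow> nat \<Rightarrow> (nat \<Rightarrow> real) \<Rightarrow> (nat \<Rightarrow> real) \<Rightarrow> (nat \<Rightarrow> real) \<Rightarrow> (nat \<Rightarrow> real) \<Rightarrow> real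
     \<Rightarrow> (nat \<Rightarrow> real) \<Rightarrow> real" where
  "E n m lev a k d A \<xi> =
     - (\<Sum>i<m. k i * (lev (Suc i) - lev i) * ln (Gxi n (a i) \<xi> (Suc i) - Gxi n (a i) \<xi> i))
     + k m * A * G n (\<xi> m / a m) + 1/4 * (\<Sum>i=1..m. d i * (\<xi> i)\<^sup>2)"

definition critical_point :: "nat \<Rightarrow> ((nat \<Rightarrow> real) \<Rightarrow> real) \<Rightarrow> (nat \<Rightarrow> real) \<Rightarrow> bool" where
  "critical_point m F \<xi> \<longleftrightarrow>
     (\<forall>i\<in>{1..m}. ((\<lambda>s. F (\<xi>(i := s))) has_real_derivative 0) (at (\<xi> i)))"

end

theory Submission
  imports Defs
begin

text \<open>
  In the variables \<open>\<tau>\<^sub>i = ln \<xi>\<^sub>i\<close> the function \<open>E\<close> is strictly convex: \<open>G\<close> becomes an integral of the density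
  \<open>e\<^bsup>(2-n)\<tau>\<^esup> exp (- e\<^bsup>2\<tau>\<^esup> / 4)\<close>, which is log-concave because \<open>n \<ge> 2\<close>, so the negative logarithm of
  its integral over an interval is convex in the end points. A critical point therefore lies strictly
  below every other point of \<open>Omega m\<close>, and one exists since \<open>E\<close> is coercive on \<open>Omega m\<close>. Evaluated at
  \<open>t = 1\<close>, the Stefan conditions on the surfaces \<open>|x| = \<xi>\<^sub>i \<surd>t\<close> say that \<open>\<xi>\<close> is critical.
\<close>

subsection \<open>Properties of \<open>G\<close>\<close>

text \<open>In the radii themselves the argument fails:
  \<open>s powi (1 - int n) * exp (- s\<^sup>2 / 4)\<close> is log-convex near 0. Passing to tau =
  ln s adds the factor s from ds = s dtau to the density, and turns the scalings by the different
  \<open>a i\<close> into translations, so the same displacements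
  \<open>ln (\<eta> j / \<xi> j)\<close> serve all phases. Convexity is used only as a tangent
  inequality between two points, proved term by term by differentiating twice along a segment in
  tau. The delicate point is strictness. A logarithmic term does not notice a common translation of
  its two ends, the outermost phase has only one finite end and enters with a weak inequality, and
  the square terms vanish when \<open>d i = 0\<close>. The term with
  \<open>G n (\<xi> m / a m)\<close> is strictly convex and anchors the innermost radius;
  differences of displacements then propagate outwards.\<close>

definition ker :: "nat \<Rightarrow> real \<Rightarrow> real" where
  "ker n s = s powi (1 - int n) * exp (- s\<^sup>2 / 4)"

text \<open>The density of the measure \<open>ker n s\<close> ds with respect to tau = ln s, hence
  minus the tau-derivative of \<open>G\<close>.\<close>

abbreviation wker :: "nat \<Rightarrow> real \<Rightarrow> real" where
  "wker n s \<equiv> s * ker n s"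

lemma ker_pos: "0 < s \<Longrightarrow> 0 < ker n s"
  by (simp add: ker_def)

lemma DERIV_ker:
  assumes "0 < s"
  shows "(ker n has_real_derivative ((1 - real n) / s - s / 2) * ker n s) (at s)"
proof -
  have eq: "s powi (1 - int n - 1) = s powi (1 - int n) / s"
    using assms by (subst power_int_diff) auto
  have 1: "((\<lambda>s. s powi (1 - int n)) has_real_derivative (1 - real n) / s * s powi (1 - int n)) (at s)"
    by (rule DERIV_cong[OF DERIV_power_int[OF DERIV_ident]]) (use assms in \<open>auto simp only: eq\<close>, simp)
  have 2: "((\<lambda>s. exp (- s\<^sup>2 / 4)) has_real_derivative - s / 2 * exp (- s\<^sup>2 / 4)) (at s)"
    by (auto intro!: derivative_eq_intros)
  show ?thesis
    unfolding ker_def[abs_def] by (rule DERIV_cong[OF DERIV_mult[OF 1 2]]) (simp add: algebra_simps)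
qed

lemma continuous_on_ker: "continuous_on {0<..} (ker n)"
  by (meson DERIV_ker DERIV_isCont continuous_at_imp_continuous_on greaterThan_iff)

text \<open>In tau, the logarithmic derivative of the density is minus
  \<open>real n - 2 + s\<^sup>2 / 2\<close>. That this factor increases with s is log-concavity in
  differential form.\<close>

lemma DERIV_wker:
  assumes "0 < s"
  shows "(wker n has_real_derivative - (real n - 2 + s\<^sup>2 / 2) * ker n s) (at s)"
  by (rule DERIV_mult[OF DERIV_ident DERIV_ker[OF assms], THEN DERIV_cong])
     (use assms in \<open>simp add: field_simps power2_eq_square\<close>)

text \<open>Splitting off \<open>s powi (- int n)\<close>, which is largest at \<open>y\<close>,
  leaves a function with an elementary antiderivative: an explicit integrable majorant.\<close>

lemma ker_le:
  assumes "0 < y" "y \<le> s"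
  shows "ker n s \<le> y powi (- int n) * (s * exp (- s\<^sup>2 / 4))"
proof -
  have "s powi (1 - int n) = s * s powi (- int n)"
    using assms power_int_add[of s 1 "- int n"] by simp
  moreover have "s powi (- int n) \<le> y powi (- int n)"
    using assms by (simp add: power_int_minus le_imp_inverse_le power_mono)
  ultimately show ?thesis
    using assms by (simp add: ker_def mult.assoc mult_left_mono mult_right_mono)
qed

lemma gauss_tendsto_0: "((\<lambda>s::real. 2 * exp (- s\<^sup>2 / 4)) \<longlongrightarrow> 0) at_top"
proof (rule tendsto_sandwich[where f = "\<lambda>_. 0"])
  have "((\<lambda>s::real. exp (- s)) \<longlongrightarrow> 0) at_top"
    by (rule filterlim_compose[OF exp_at_bot filterlim_uminus_at_bot_at_top])
  from tendsto_mult_right_zero[OF this] show "((\<lambda>s::real. 2 * exp (- s)) \<longlongrightarrow> 0) at_top" .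
  show "\<forall>\<^sub>F s::real in at_top. 2 * exp (- s\<^sup>2 / 4) \<le> 2 * exp (- s)"
    using eventually_ge_at_top[of 4] by eventually_elim (simp add: power2_eq_square)
qed auto

text \<open>\<open>- 2 * exp (- s\<^sup>2 / 4)\<close> is an antiderivative that vanishes at
  infinity; as the integrand is nonnegative, the fundamental theorem on a half-line gives
  integrability and value together.\<close>

lemma gauss_moment_tail:
  fixes y :: real
  assumes "0 < y"
  shows "set_integrable lborel {y..} (\<lambda>s. s * exp (- s\<^sup>2 / 4))"
    and "(LBINT s:{y..}. s * exp (- s\<^sup>2 / 4)) = 2 * exp (- y\<^sup>2 / 4)"
proof -
  have *: "((\<lambda>s::real. - 2 * exp (- s\<^sup>2 / 4)) \<longlongrightarrow> 0) at_top"
    using tendsto_minus[OF gauss_tendsto_0] by simp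
  have "has_bochner_integral lborel (\<lambda>s. (s * exp (- s\<^sup>2 / 4)) * indicator {y..} s) (0 - (- 2 * exp (- y\<^sup>2 / 4)))"
  proof (rule has_bochner_integral_nn_integral)
    show "(\<integral>\<^sup>+ s. ennreal (s * exp (- s\<^sup>2 / 4) * indicator {y..} s) \<partial>lborel) = ennreal (0 - (- 2 * exp (- y\<^sup>2 / 4)))"
    proof -
      have "(\<integral>\<^sup>+ s. ennreal (s * exp (- s\<^sup>2 / 4)) * indicator {y..} s \<partial>lborel) = ennreal (0 - (- 2 * exp (- y\<^sup>2 / 4)))"
        using assms by (intro nn_integral_FTC_atLeast *) (auto intro!: derivative_eq_intros simp: field_simps)
      then show ?thesis by (simp add: ennreal_mult'' ennreal_indicator)
    qed
  qed (use assms in \<open>auto simp: indicator_def\<close>)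
  then show "set_integrable lborel {y..} (\<lambda>s. s * exp (- s\<^sup>2 / 4))"
    and "(LBINT s:{y..}. s * exp (- s\<^sup>2 / 4)) = 2 * exp (- y\<^sup>2 / 4)"
    by (auto simp: set_integrable_def set_lebesgue_integral_def has_bochner_integral_iff mult.commute mult.left_commute)
qed

lemma set_integrable_ker:
  assumes "0 < y"
  shows "set_integrable lborel {y..} (ker n)"
proof (rule set_integrable_bound)
  show "set_integrable lborel {y..} (\<lambda>s. y powi (- int n) * (s * exp (- s\<^sup>2 / 4)))"
    using gauss_moment_tail(1)[OF assms] by simp
  show "set_borel_measurable lborel {y..} (ker n)"
    unfolding set_borel_measurable_def ker_def power_int_def by measurable
  show "AE s in lborel. s \<in> {y..} \<longrightarrow> norm (ker n s) \<le> norm (y powi (- int n) * (s * exp (- s\<^sup>2 / 4)))"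
    using assms ker_le[OF assms, of _ n] ker_pos[of _ n]
    by (auto simp: abs_mult intro!: AE_I2) (smt (verit) ker_pos)
qed

lemma G_eq: "G n y = (LBINT s:{y..}. ker n s)"
  by (simp add: G_def ker_def)

lemma G_nonneg: "0 < y \<Longrightarrow> 0 \<le> G n y"
  unfolding G_eq set_lebesgue_integral_def
  by (intro integral_nonneg_AE AE_I2) (auto simp: indicator_def ker_def)

text \<open>Near \<open>y\<close>, \<open>G\<close> is a constant minus an integral over the compact
  interval \<open>{a..z}\<close>, to which the fundamental theorem applies. Any \<open>a\<close> in
  (0, y) and any \<open>b\<close> above \<open>y\<close> would do.\<close>

lemma DERIV_G:
  assumes "0 < y"
  shows "(G n has_real_derivative - ker n y) (at y)"
proof -
  define a b where "a = y / 2" and "b = y + 1"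
  have ab: "0 < a" "a < y" "y < b" using assms by (auto simp: a_def b_def)
  have eq: "G n z = G n a - integral {a..z} (ker n)" if "z \<in> {a..b}" for z
  proof -
    have "G n a = (LBINT s:{a..<z} \<union> {z..}. ker n s)"
      using that by (simp add: G_eq ivl_disj_un)
    also have "\<dots> = (LBINT s:{a..<z}. ker n s) + (LBINT s:{z..}. ker n s)"
      by (intro set_integral_Un set_integrable_subset[OF set_integrable_ker[OF ab(1)]]) (use that in auto)
    also have "(LBINT s:{a..<z}. ker n s) = integral {a..<z} (ker n)"
      by (intro set_borel_integral_eq_integral set_integrable_subset[OF set_integrable_ker[OF ab(1)]]) auto
    also have "\<dots> = integral {a..z} (ker n)"
      by (rule integral_spike_set) (auto intro: negligible_subset[OF negligible_sing[of z]])
    finally show ?thesis by (simp add: G_eq)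
  qed
  have "((\<lambda>z. integral {a..z} (ker n)) has_real_derivative ker n y) (at y within {a..b})"
    by (rule integral_has_real_derivative)
       (use ab in \<open>auto intro: continuous_on_subset[OF continuous_on_ker]\<close>)
  then have "((\<lambda>z. G n a - integral {a..z} (ker n)) has_real_derivative - ker n y) (at y within {a..b})"
    by (auto intro!: derivative_eq_intros)
  then have "(G n has_real_derivative - ker n y) (at y within {a..b})"
    by (rule has_field_derivative_transform_within[where d = 1]) (use ab in \<open>simp_all add: eq[symmetric]\<close>)
  then show ?thesis using ab at_within_Icc_at[of a y b] by simp
qed

lemma DERIV_G_chain [derivative_intros]:
  assumes "(f has_real_derivative f') (at x within S)" "0 < f x"
  shows "((\<lambda>x. G n (f x)) has_real_derivative - ker n (f x) * f') (at x within S)"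
  using DERIV_chain2[OF DERIV_G[OF assms(2)] assms(1)] by simp

lemma continuous_on_G: "continuous_on {0<..} (G n)"
  by (meson DERIV_G DERIV_isCont continuous_at_imp_continuous_on greaterThan_iff)

section \<open>Size of \<open>G\<close>: monotonicity, decay at infinity, blow-up at 0\<close>

lemma G_strict_antimono:
  assumes "0 < y" "y < z"
  shows "G n z < G n y"
proof (rule DERIV_neg_imp_decreasing[OF assms(2)])
  fix s assume "y \<le> s" "s \<le> z"
  then show "\<exists>D. (G n has_real_derivative D) (at s) \<and> D < 0"
    using assms by (intro exI[of _ "- ker n s"]) (simp add: DERIV_G ker_pos)
qed

lemma G_pos: "0 < y \<Longrightarrow> 0 < G n y"
  using G_strict_antimono[of y "y + 1" n] G_nonneg[of "y + 1" n] by simp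

lemma G_tendsto_0: "(G n \<longlongrightarrow> 0) at_top"
proof (rule tendsto_sandwich)
  show "\<forall>\<^sub>F y in at_top. 0 \<le> G n y"
    using eventually_gt_at_top[of 0] by eventually_elim (rule G_nonneg)
  show "\<forall>\<^sub>F y in at_top. G n y \<le> 2 * exp (- y\<^sup>2 / 4)"
    using eventually_gt_at_top[of 1]
  proof eventually_elim
    case (elim y)
    then have "G n y \<le> (LBINT s:{y..}. s * exp (- s\<^sup>2 / 4))"
      unfolding G_eq using ker_le[of y _ n] ker_le[of 1 _ n]
      by (intro set_integral_mono set_integrable_ker gauss_moment_tail) auto
    then show ?case using gauss_moment_tail(2)[of y] elim by simp
  qed
qed (use gauss_tendsto_0 in auto)

text \<open>For s in (0, 1] and n >= 2 the kernel is at least \<open>exp (- 1 / 4) / s\<close>, so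
  \<open>G n y + exp (- 1 / 4) * ln y\<close> does not increase up to \<open>y = 1\<close>, where it
  is nonnegative. A logarithm is the true order of growth for n = 2.\<close>

lemma G_ge_ln:
  assumes "2 \<le> n" "0 < y" "y \<le> 1"
  shows "- exp (- 1 / 4) * ln y \<le> G n y"
proof -
  have "G n 1 + exp (- 1 / 4) * ln 1 \<le> G n y + exp (- 1 / 4) * ln y"
  proof (rule DERIV_nonpos_imp_nonincreasing[OF assms(3)])
    fix s assume s: "y \<le> s" "s \<le> 1"
    have "exp (- 1 / 4) / s \<le> ker n s"
    proof -
      have "s powi (- 1) \<le> s powi (1 - int n)"
        using assms s by (intro power_int_decreasing) auto
      moreover have "exp (- 1 / 4) \<le> exp (- s\<^sup>2 / 4)"
        using s assms by (simp add: power_le_one)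
      ultimately have "s powi (- 1) * exp (- 1 / 4) \<le> ker n s"
        unfolding ker_def using assms s by (intro mult_mono) auto
      then show ?thesis by (simp only: power_int_minus1_right divide_inverse mult.commute)
    qed
    moreover have "((\<lambda>y. G n y + exp (- 1 / 4) * ln y) has_real_derivative - ker n s + exp (- 1 / 4) / s) (at s)"
      using assms s by (auto intro!: derivative_eq_intros)
    ultimately show "\<exists>D. ((\<lambda>y. G n y + exp (- 1 / 4) * ln y) has_real_derivative D) (at s) \<and> D \<le> 0"
      by force
  qed
  then show ?thesis using G_nonneg[of 1 n] by simp
qed

lemma filterlim_G_at_top:
  assumes "2 \<le> n"
  shows "filterlim (G n) at_top (at_right 0)"
proof (rule filterlim_at_top_mono)
  have "filterlim (\<lambda>y::real. exp (- 1 / 4) * - ln y) at_top (at_right 0)"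
    using ln_at_0 by (intro filterlim_tendsto_pos_mult_at_top[OF tendsto_const]) (auto simp: filterlim_uminus_at_top)
  then show "filterlim (\<lambda>y::real. - exp (- 1 / 4) * ln y) at_top (at_right 0)" by simp
  show "\<forall>\<^sub>F y in at_right 0. - exp (- 1 / 4) * ln y \<le> G n y"
    unfolding eventually_at_right_field using G_ge_ln[OF assms] by (intro exI[of _ 1]) auto
qed

text \<open>Makes the values of \<open>G\<close> in phases with different \<open>a i\<close>
  comparable near 0. The factor \<open>c powi (2 - int n)\<close> comes from substituting
  \<open>c * s\<close> into the kernel; \<open>exp (1 / 4)\<close> makes up for the Gaussian factor
  of \<open>ker n s\<close>, which is at least \<open>exp (- 1 / 4)\<close> for s <= 1.\<close>

lemma G_scale_le:
  assumes "2 \<le> n" "0 < c" "0 < y" "y \<le> 1"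
  shows "G n (c * y) \<le> exp (1 / 4) * c powi (2 - int n) * G n y + G n c"
proof -
  define K where "K = exp (1 / 4) * c powi (2 - int n)"
  \<comment> \<open>The difference does not increase on (0, 1], so it is bounded below by its value
    at 1, which is at least \<open>- G n c\<close>.\<close>
  have "K * G n 1 - G n (c * 1) \<le> K * G n y - G n (c * y)"
  proof (rule DERIV_nonpos_imp_nonincreasing[OF assms(4)])
    fix s assume s: "y \<le> s" "s \<le> 1"
    have "ker n (c * s) * c \<le> K * ker n s"
    proof -
      have "ker n (c * s) * c = c powi (2 - int n) * s powi (1 - int n) * exp (- (c * s)\<^sup>2 / 4)"
      proof -
        have "c powi (2 - int n) = c powi (1 - int n) * c"
          using power_int_add_1[of c "1 - int n"] assms(2) by (simp add: algebra_simps)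
        then show ?thesis by (simp only: ker_def power_int_mult_distrib mult_ac)
      qed
      also have "\<dots> \<le> c powi (2 - int n) * s powi (1 - int n) * exp (1 / 4 - s\<^sup>2 / 4)"
      proof (rule mult_left_mono)
        have "s\<^sup>2 \<le> 1" using assms s by (simp add: power_le_one)
        then have "- (c * s)\<^sup>2 / 4 \<le> 1 / 4 - s\<^sup>2 / 4"
          using zero_le_power2[of "c * s"] by argo
        then show "exp (- (c * s)\<^sup>2 / 4) \<le> exp (1 / 4 - s\<^sup>2 / 4)" by simp
      qed (use assms s in auto)
      also have "\<dots> = K * ker n s"
        by (simp add: K_def ker_def mult_exp_exp)
      finally show ?thesis .
    qed
    moreover have "((\<lambda>y. K * G n y - G n (c * y)) has_real_derivative - K * ker n s + ker n (c * s) * c) (at s)"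
      using assms s by (auto intro!: derivative_eq_intros)
    ultimately show "\<exists>D. ((\<lambda>y. K * G n y - G n (c * y)) has_real_derivative D) (at s) \<and> D \<le> 0"
      by force
  qed
  moreover have "0 \<le> K * G n 1"
    using assms G_nonneg[of 1 n] by (simp add: K_def)
  ultimately show ?thesis by (simp add: K_def)
qed


subsection \<open>Convexity in logarithmic variables\<close>

text \<open>Two mean values: \<open>f 1 - f 0 = f' c\<close> and
  \<open>f' c - f' 0 = c * f'' e\<close> with 0 < e < c < 1. The sign of \<open>f'' e\<close>
  decides between the weak and the strict version.\<close>

lemma concave_below_tangent:
  fixes f :: "real \<Rightarrow> real"
  assumes f': "\<And>t. 0 \<le> t \<Longrightarrow> t \<le> 1 \<Longrightarrow> (f has_real_derivative f' t) (at t)"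
    and f'': "\<And>t. 0 \<le> t \<Longrightarrow> t \<le> 1 \<Longrightarrow> (f' has_real_derivative f'' t) (at t)"
  shows "(\<And>t. 0 \<le> t \<Longrightarrow> t \<le> 1 \<Longrightarrow> f'' t \<le> 0) \<Longrightarrow> f 1 \<le> f 0 + f' 0"
    and "(\<And>t. 0 \<le> t \<Longrightarrow> t \<le> 1 \<Longrightarrow> f'' t < 0) \<Longrightarrow> f 1 < f 0 + f' 0"
proof -
  obtain c where c: "0 < c" "c < 1" "f 1 - f 0 = (1 - 0) * f' c"
    using MVT2[of 0 1 f f'] f' by auto
  obtain e where e: "0 < e" "e < c" "f' c - f' 0 = (c - 0) * f'' e"
    using MVT2[of 0 c f' f''] f'' c by auto
  show "f 1 \<le> f 0 + f' 0" if "\<And>t. 0 \<le> t \<Longrightarrow> t \<le> 1 \<Longrightarrow> f'' t \<le> 0"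
    using c e that[of e] mult_nonneg_nonpos[of c "f'' e"] by simp
  show "f 1 < f 0 + f' 0" if "\<And>t. 0 \<le> t \<Longrightarrow> t \<le> 1 \<Longrightarrow> f'' t < 0"
    using c e that[of e] mult_pos_neg[of c "f'' e"] by simp
qed

lemma DERIV_wker_chain:
  assumes "(f has_real_derivative f') (at t)" "0 < f t"
  shows "((\<lambda>t. wker n (f t)) has_real_derivative - (real n - 2 + (f t)\<^sup>2 / 2) * ker n (f t) * f') (at t)"
  using DERIV_chain2[OF DERIV_wker[OF assms(2)] assms(1)] by simp

text \<open>Cauchy's mean value theorem for \<open>wker\<close> and \<open>G\<close>: the quotient
  of their increments is \<open>real n - 2 + c\<^sup>2 / 2\<close> for some c between
  \<open>y\<close> and \<open>x\<close>, and this is monotone in c. It relates the mass of an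
  interval to the density at its ends, which is how log-concavity enters.\<close>

lemma wker_diff_bounds:
  assumes "0 < y" "y < x"
  shows "(real n - 2 + y\<^sup>2 / 2) * (G n y - G n x) \<le> wker n y - wker n x"
    and "wker n y - wker n x \<le> (real n - 2 + x\<^sup>2 / 2) * (G n y - G n x)"
proof -
  have "\<exists>c>y. c < x \<and> (G n x - G n y) * (- (real n - 2 + c\<^sup>2 / 2) * ker n c)
      = (wker n x - wker n y) * - ker n c"
  proof (rule GMVT'[OF assms(2)])
    fix z assume "y \<le> z" "z \<le> x"
    then show "isCont (G n) z" "isCont (wker n) z"
      using assms DERIV_isCont[OF DERIV_G] DERIV_isCont[OF DERIV_wker] by auto
  qed (use assms in \<open>auto intro!: DERIV_G DERIV_wker[THEN DERIV_cong]\<close>)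
  then obtain c where c: "y < c" "c < x"
    and "(G n x - G n y) * (- (real n - 2 + c\<^sup>2 / 2) * ker n c) = (wker n x - wker n y) * - ker n c"
    by auto
  then have "ker n c * ((real n - 2 + c\<^sup>2 / 2) * (G n y - G n x)) = ker n c * (wker n y - wker n x)"
    by (simp add: field_simps)
  then have eq: "wker n y - wker n x = (real n - 2 + c\<^sup>2 / 2) * (G n y - G n x)"
    using ker_pos[of c n] c assms by simp
  have "y\<^sup>2 \<le> c\<^sup>2" "c\<^sup>2 \<le> x\<^sup>2"
    using c assms by (auto intro!: power_mono)
  moreover have "0 \<le> G n y - G n x"
    using G_strict_antimono[OF assms, of n] by simp
  ultimately show "(real n - 2 + y\<^sup>2 / 2) * (G n y - G n x) \<le> wker n y - wker n x"
    and "wker n y - wker n x \<le> (real n - 2 + x\<^sup>2 / 2) * (G n y - G n x)"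
    unfolding eq by (intro mult_right_mono; simp)+
qed

text \<open>The curves are straight segments in tau. The difference of the logarithms along them is
  a convex combination of two positive numbers.\<close>

lemma log_segment_less:
  fixes x y :: real
  assumes "0 < y" "y < x" "0 < y'" "y' < x'" "0 \<le> t" "t \<le> 1"
  shows "y * exp (t * ln (y' / y)) < x * exp (t * ln (x' / x))"
proof -
  have "0 < (1 - t) * (ln x - ln y) + t * (ln x' - ln y')"
  proof (cases "t = 1")
    case False
    then show ?thesis
      using assms by (intro add_pos_nonneg mult_pos_pos mult_nonneg_nonneg) auto
  qed (use assms in simp)
  then have "ln y + t * ln (y' / y) < ln x + t * ln (x' / x)"
    using assms by (simp add: ln_div algebra_simps)
  then have "exp (ln y + t * ln (y' / y)) < exp (ln x + t * ln (x' / x))"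
    by simp
  then show ?thesis using assms by (simp add: exp_add)
qed

text \<open>A one-dimensional Prekopa inequality. \<open>F\<close> is the mass of an interval whose
  lower and upper ends move in tau with speeds \<open>p\<close> and \<open>q\<close>. The numerator
  of the second derivative of \<open>ln F\<close> is at most minus the product of the end densities
  times \<open>(p - q)\<^sup>2\<close>, so concavity is strict unless the interval is translated
  rigidly.\<close>

lemma ln_G_diff_below_tangent:
  assumes "2 \<le> n" "0 < y" "y < x" "0 < y'" "y' < x'"
  shows "ln (G n y' - G n x') \<le>
      ln (G n y - G n x) + (wker n x * ln (x' / x) - wker n y * ln (y' / y)) / (G n y - G n x)"
    and "ln (y' / y) \<noteq> ln (x' / x) \<Longrightarrow> ln (G n y' - G n x') <
      ln (G n y - G n x) + (wker n x * ln (x' / x) - wker n y * ln (y' / y)) / (G n y - G n x)"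
proof -
  define p q where "p = ln (y' / y)" and "q = ln (x' / x)"
  define Y X where "Y t = y * exp (t * p)" and "X t = x * exp (t * q)" for t
  define r where "r s = real n - 2 + s\<^sup>2 / 2" for s :: real
  define F where "F t = G n (Y t) - G n (X t)" for t
  define F' where "F' t = wker n (X t) * q - wker n (Y t) * p" for t
  define F'' where "F'' t = - r (X t) * wker n (X t) * q\<^sup>2 + r (Y t) * wker n (Y t) * p\<^sup>2" for t
  have pos: "0 < Y t" "0 < X t" for t
    using assms by (auto simp: X_def Y_def)
  have YX: "Y t < X t" if "0 \<le> t" "t \<le> 1" for t
    unfolding X_def Y_def p_def q_def by (rule log_segment_less[OF assms(2-5) that])
  have Fpos: "0 < F t" if "0 \<le> t" "t \<le> 1" for t
    using G_strict_antimono[OF pos(1) YX[OF that], of n] by (simp add: F_def)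
  have dY: "(Y has_real_derivative Y t * p) (at t)" and dX: "(X has_real_derivative X t * q) (at t)" for t
    unfolding X_def[abs_def] Y_def[abs_def] by (auto intro!: derivative_eq_intros)
  have dF: "(F has_real_derivative F' t) (at t)" for t
    unfolding F_def[abs_def]
    by (rule DERIV_cong[OF DERIV_diff[OF DERIV_G_chain[OF dY pos(1)] DERIV_G_chain[OF dX pos(2)]]])
       (simp add: F'_def)
  have dF': "(F' has_real_derivative F'' t) (at t)" for t
    unfolding F'_def[abs_def]
    by (rule DERIV_cong[OF DERIV_diff[OF DERIV_cmult_right[OF DERIV_wker_chain[OF dX pos(2)]]
             DERIV_cmult_right[OF DERIV_wker_chain[OF dY pos(1)]]]])
       (simp add: F''_def r_def power2_eq_square algebra_simps)
  have d1: "((\<lambda>t. ln (F t)) has_real_derivative F' t / F t) (at t)" if "0 \<le> t" "t \<le> 1" for t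
    using DERIV_ln_divide[OF Fpos[OF that]] DERIV_chain2[OF _ dF, of ln "1 / F t" t] by simp
  have d2: "((\<lambda>t. F' t / F t) has_real_derivative (F'' t * F t - F' t * F' t) / (F t * F t)) (at t)"
    if "0 \<le> t" "t \<le> 1" for t
    using Fpos[OF that] by (intro DERIV_divide dF dF') simp
  have bound: "F'' t * F t - F' t * F' t \<le> - (wker n (X t) * wker n (Y t) * (p - q)\<^sup>2)"
    if "0 \<le> t" "t \<le> 1" for t
  proof -
    define a b where "a = wker n (X t)" and "b = wker n (Y t)"
    have ab: "0 < a" "0 < b" using pos ker_pos by (simp_all add: a_def b_def)
    have "r (Y t) * F t \<le> b - a" "b - a \<le> r (X t) * F t"
      using wker_diff_bounds[OF pos(1) YX[OF that]] by (simp_all add: r_def F_def a_def b_def)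
    then have "r (Y t) * F t * (b * p\<^sup>2) \<le> (b - a) * (b * p\<^sup>2)"
      "(b - a) * (a * q\<^sup>2) \<le> r (X t) * F t * (a * q\<^sup>2)"
      using ab by (intro mult_right_mono; simp)+
    \<comment> \<open>Both terms of \<open>F'' t * F t\<close> contain a product of \<open>r\<close>
      and \<open>F\<close>, and its bound by \<open>b - a\<close> has the direction that the sign of
      the term requires. The rest is an identity in \<open>a\<close>, \<open>b\<close>,
      \<open>p\<close>, \<open>q\<close>.\<close>
    then have "F'' t * F t - F' t * F' t \<le> (b - a) * (b * p\<^sup>2) - (b - a) * (a * q\<^sup>2) - (a * q - b * p)\<^sup>2"
      unfolding F''_def F'_def a_def[symmetric] b_def[symmetric] by (simp add: power2_eq_square algebra_simps)
    also have "\<dots> = - (a * b * (p - q)\<^sup>2)"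
      by (simp add: power2_eq_square algebra_simps)
    finally show ?thesis by (simp add: a_def b_def)
  qed
  have ends: "Y 0 = y" "X 0 = x" "Y 1 = y'" "X 1 = x'"
    using assms by (simp_all add: Y_def X_def p_def q_def)
  have wpos: "0 < wker n (X t) * wker n (Y t)" for t
    using pos[of t] ker_pos[of _ n] by simp
  have "ln (F 1) \<le> ln (F 0) + F' 0 / F 0"
  proof (rule concave_below_tangent(1)[OF d1 d2])
    fix t :: real assume t: "0 \<le> t" "t \<le> 1"
    have "F'' t * F t - F' t * F' t \<le> 0"
      using bound[OF t] wpos[of t] by (smt (verit) mult_nonneg_nonneg zero_le_power2)
    then show "(F'' t * F t - F' t * F' t) / (F t * F t) \<le> 0"
      by (simp add: divide_nonpos_nonneg)
  qed
  then show "ln (G n y' - G n x') \<le>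
      ln (G n y - G n x) + (wker n x * ln (x' / x) - wker n y * ln (y' / y)) / (G n y - G n x)"
    by (simp add: F_def F'_def ends p_def q_def)
  show "ln (G n y' - G n x') <
      ln (G n y - G n x) + (wker n x * ln (x' / x) - wker n y * ln (y' / y)) / (G n y - G n x)"
    if "ln (y' / y) \<noteq> ln (x' / x)"
  proof -
    have pq: "0 < (p - q)\<^sup>2" using that by (simp add: p_def q_def)
    have "ln (F 1) < ln (F 0) + F' 0 / F 0"
    proof (rule concave_below_tangent(2)[OF d1 d2])
      fix t :: real assume t: "0 \<le> t" "t \<le> 1"
      have "F'' t * F t - F' t * F' t < 0"
        using bound[OF t] mult_pos_pos[OF wpos[of t] pq] by linarith
      then show "(F'' t * F t - F' t * F' t) / (F t * F t) < 0"
        using Fpos[OF t] by (simp add: divide_neg_pos)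
    qed
    then show ?thesis
      by (simp add: F_def F'_def ends p_def q_def)
  qed
qed

text \<open>The outermost interval reaches to infinity. Its inequality is the limit of the two-ended
  one with the upper end held fixed at \<open>x\<close>, so that it has displacement 0, as
  \<open>x\<close> grows; only the weak form survives.\<close>

lemma ln_G_below_tangent:
  assumes "2 \<le> n" "0 < y" "0 < y'"
  shows "ln (G n y') \<le> ln (G n y) - wker n y * ln (y' / y) / G n y"
proof (rule tendsto_le)
  have "((\<lambda>x. ln (G n y - G n x) - wker n y * ln (y' / y) / (G n y - G n x)) \<longlongrightarrow>
      ln (G n y - 0) - wker n y * ln (y' / y) / (G n y - 0)) at_top"
    using G_pos[OF assms(2), of n] by (intro tendsto_intros G_tendsto_0) auto
  then show "((\<lambda>x. ln (G n y - G n x) - wker n y * ln (y' / y) / (G n y - G n x)) \<longlongrightarrow>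
      ln (G n y) - wker n y * ln (y' / y) / G n y) at_top" by simp
  have "((\<lambda>x. ln (G n y' - G n x)) \<longlongrightarrow> ln (G n y' - 0)) at_top"
    using G_pos[OF assms(3), of n] by (intro tendsto_intros G_tendsto_0) auto
  then show "((\<lambda>x. ln (G n y' - G n x)) \<longlongrightarrow> ln (G n y')) at_top" by simp
  show "\<forall>\<^sub>F x in at_top. ln (G n y' - G n x) \<le>
      ln (G n y - G n x) - wker n y * ln (y' / y) / (G n y - G n x)"
    using eventually_gt_at_top[of "max y y'"]
  proof eventually_elim
    case (elim x)
    then show ?case
      using ln_G_diff_below_tangent(1)[of n y x y' x] assms by simp
  qed
qed simp

text \<open>The second tau-derivative of \<open>G\<close> is
  \<open>(real n - 2 + s\<^sup>2 / 2) * wker n s\<close>, positive because n >= 2; concavity is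
  applied to \<open>- G\<close>.\<close>

lemma G_above_tangent:
  assumes "2 \<le> n" "0 < y" "0 < y'"
  shows "G n y - wker n y * ln (y' / y) \<le> G n y'"
    and "y' \<noteq> y \<Longrightarrow> G n y - wker n y * ln (y' / y) < G n y'"
proof -
  define p where "p = ln (y' / y)"
  define Y where "Y t = y * exp (t * p)" for t
  have pos: "0 < Y t" for t using assms by (simp add: Y_def)
  have dY: "(Y has_real_derivative Y t * p) (at t)" for t
    unfolding Y_def[abs_def] by (auto intro!: derivative_eq_intros)
  have d1: "((\<lambda>t. - G n (Y t)) has_real_derivative wker n (Y t) * p) (at t)" for t
    by (rule DERIV_cong[OF DERIV_minus[OF DERIV_G_chain[OF dY pos]]]) simp
  have d2: "((\<lambda>t. wker n (Y t) * p) has_real_derivative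
      - ((real n - 2 + (Y t)\<^sup>2 / 2) * wker n (Y t) * p\<^sup>2)) (at t)" for t
    by (rule DERIV_cong[OF DERIV_cmult_right[OF DERIV_wker_chain[OF dY pos]]])
       (simp add: power2_eq_square algebra_simps)
  have curv: "0 < (real n - 2 + (Y t)\<^sup>2 / 2) * wker n (Y t)" for t
    using assms pos[of t] ker_pos[OF pos, of n t] by (intro mult_pos_pos add_nonneg_pos) auto
  have ends: "Y 0 = y" "Y 1 = y'"
    using assms by (simp_all add: Y_def p_def)
  have "- G n (Y 1) \<le> - G n (Y 0) + wker n (Y 0) * p"
    by (rule concave_below_tangent(1)[OF d1 d2]) (use curv in \<open>simp add: less_imp_le\<close>)
  then show "G n y - wker n y * ln (y' / y) \<le> G n y'"
    by (simp add: ends p_def)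
  assume "y' \<noteq> y"
  then have "p \<noteq> 0" using assms by (simp add: p_def)
  then have "- G n (Y 1) < - G n (Y 0) + wker n (Y 0) * p"
    by (intro concave_below_tangent(2)[OF d1 d2]) (use curv in simp)
  then show "G n y - wker n y * ln (y' / y) < G n y'"
    by (simp add: ends p_def)
qed

text \<open>Convexity of exp(2 tau), as \<open>ln z \<le> z - 1\<close> at
  \<open>z = (y' / y)\<^sup>2\<close>.\<close>

lemma square_above_tangent:
  fixes y y' :: real
  assumes "0 < y" "0 < y'"
  shows "y\<^sup>2 + 2 * y\<^sup>2 * ln (y' / y) \<le> y'\<^sup>2"
proof -
  have "2 * ln (y' / y) \<le> (y' / y)\<^sup>2 - 1"
    using ln_le_minus_one[of "(y' / y)\<^sup>2"] assms by (simp add: ln_realpow)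
  then have "y\<^sup>2 * (2 * ln (y' / y)) \<le> y\<^sup>2 * ((y' / y)\<^sup>2 - 1)"
    by (intro mult_left_mono) auto
  then show ?thesis
    using assms by (simp add: power_divide algebra_simps)
qed


subsection \<open>The energy and its critical points\<close>

lemma Omega_less:
  assumes "\<xi> \<in> Omega m" "1 \<le> i" "i < j" "j \<le> m"
  shows "\<xi> j < \<xi> i"
  using assms(3,4)
proof (induction j)
  case (Suc j)
  have "\<xi> (Suc j) < \<xi> j"
    using assms(1,2) Suc.prems by (auto simp: Omega_def)
  then show ?case
    using Suc by (cases "i = j") auto
qed simp

lemma Omega_pos:
  assumes "\<xi> \<in> Omega m" "1 \<le> i" "i \<le> m"
  shows "0 < \<xi> i"
proof (cases "i = m")
  case False
  then show ?thesis
    using Omega_less[OF assms(1,2), of m] assms by (auto simp: Omega_def)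
qed (use assms in \<open>auto simp: Omega_def\<close>)

locale stefan =
  fixes n m :: nat and lev a k d :: "nat \<Rightarrow> real" and A :: real
  assumes n: "2 \<le> n" and m: "1 \<le> m"
    and lev: "\<And>i. i < m \<Longrightarrow> lev i < lev (Suc i)"
    and a: "\<And>i. i \<le> m \<Longrightarrow> 0 < a i"
    and k: "\<And>i. i \<le> m \<Longrightarrow> 0 < k i"
    and d: "\<And>i. 1 \<le> i \<Longrightarrow> i \<le> m \<Longrightarrow> 0 \<le> d i"
    and A: "0 < A"
begin

abbreviation energy :: "(nat \<Rightarrow> real) \<Rightarrow> real" where
  "energy \<equiv> E n m lev a k d A"

definition gap :: "(nat \<Rightarrow> real) \<Rightarrow> nat \<Rightarrow> real" where
  "gap \<xi> i = Gxi n (a i) \<xi> (Suc i) - Gxi n (a i) \<xi> i"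

text \<open>The coefficient of \<open>G\<close> in the profile on phase \<open>i\<close>; it lets
  all phases share the formula of \<open>profile_zone\<close>.\<close>

definition amp :: "(nat \<Rightarrow> real) \<Rightarrow> nat \<Rightarrow> real" where
  "amp \<xi> i = (if i < m then (lev (Suc i) - lev i) / gap \<xi> i else A)"

text \<open>\<open>flux \<xi> i j\<close> is \<open>- k\<^sub>i \<xi>\<^sub>j v'(\<xi>\<^sub>j)\<close> with \<open>v'\<close> taken from the side of phase \<open>i\<close>.\<close>

definition flux :: "(nat \<Rightarrow> real) \<Rightarrow> nat \<Rightarrow> nat \<Rightarrow> real" where
  "flux \<xi> i j = (if j = 0 then 0 else k i * amp \<xi> i * wker n (\<xi> j / a i))"

text \<open>\<open>\<xi> i\<close> times the partial derivative of the energy, that is, its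
  derivative in tau; equally, \<open>\<xi> i\<close> times the left side of the radial Stefan
  condition.\<close>

definition balance :: "(nat \<Rightarrow> real) \<Rightarrow> nat \<Rightarrow> real" where
  "balance \<xi> i = flux \<xi> (i - 1) i - flux \<xi> i i + d i / 2 * (\<xi> i)\<^sup>2"

lemma gap_pos:
  assumes "\<xi> \<in> Omega m" "i < m"
  shows "0 < gap \<xi> i"
  using assms a[of i] Omega_pos[OF assms(1), of "Suc i"] Omega_less[OF assms(1), of i "Suc i"]
  by (auto simp: gap_def Gxi_def intro!: G_strict_antimono G_pos divide_strict_right_mono)

lemma amp_pos: "\<xi> \<in> Omega m \<Longrightarrow> 0 < amp \<xi> i"
  using gap_pos lev A by (simp add: amp_def)

lemma energy_eq:
  "energy \<xi> = - (\<Sum>i<m. k i * (lev (Suc i) - lev i) * ln (gap \<xi> i))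
     + k m * A * G n (\<xi> m / a m) + 1 / 4 * (\<Sum>i=1..m. d i * (\<xi> i)\<^sup>2)"
  by (simp add: E_def gap_def)

text \<open>The concavity inequalities, weighted so that the coefficients of the displacements
  become fluxes.\<close>

lemma ln_gap_below_tangent:
  assumes "\<xi> \<in> Omega m" "\<eta> \<in> Omega m" "i < m"
  defines "p \<equiv> \<lambda>j. ln (\<eta> j / \<xi> j)"
  shows "k i * (lev (Suc i) - lev i) * ln (gap \<eta> i) \<le>
      k i * (lev (Suc i) - lev i) * ln (gap \<xi> i) + flux \<xi> i i * p i - flux \<xi> i (Suc i) * p (Suc i)"
    and "0 < i \<Longrightarrow> p i \<noteq> p (Suc i) \<Longrightarrow> k i * (lev (Suc i) - lev i) * ln (gap \<eta> i) <
      k i * (lev (Suc i) - lev i) * ln (gap \<xi> i) + flux \<xi> i i * p i - flux \<xi> i (Suc i) * p (Suc i)"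
proof -
  define c where "c = k i * (lev (Suc i) - lev i)"
  have c: "0 < c" using k[of i] lev[of i] assms by (simp add: c_def)
  have ai: "0 < a i" using a assms by simp
  \<comment> \<open>The value 0 at \<open>j = 0\<close> stands for the end at infinity, so that
    phase 0 obeys the same formula.\<close>
  define q where "q j = (if j = 0 then 0 else wker n (\<xi> j / a i) * p j)" for j
  have flux: "flux \<xi> i i * p i - flux \<xi> i (Suc i) * p (Suc i) = c * ((q i - q (Suc i)) / gap \<xi> i)"
  proof -
    have "flux \<xi> i j * p j = c / gap \<xi> i * q j" for j
      using assms(3) by (simp add: flux_def amp_def c_def q_def mult_ac)
    then show ?thesis by (simp only: right_diff_distrib diff_divide_distrib times_divide_eq_left times_divide_eq_right)
  qed
  have pos: "0 < \<xi> (Suc i) / a i" "0 < \<eta> (Suc i) / a i"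
    using assms ai Omega_pos by auto
  \<comment> \<open>The scale \<open>a i\<close> cancels, so the two phases meeting at radius
    \<open>j\<close> see the same displacement.\<close>
  have p: "ln (\<eta> j / a i / (\<xi> j / a i)) = p j" for j
    using ai by (simp add: p_def)
  have 1: "ln (gap \<eta> i) \<le> ln (gap \<xi> i) + (q i - q (Suc i)) / gap \<xi> i"
  proof (cases "i = 0")
    case True
    then show ?thesis
      using ln_G_below_tangent[OF n pos] ai by (simp add: gap_def Gxi_def q_def p_def)
  next
    case False
    then have "\<xi> (Suc i) / a i < \<xi> i / a i" "\<eta> (Suc i) / a i < \<eta> i / a i"
      using assms ai Omega_less by (auto intro!: divide_strict_right_mono)
    from ln_G_diff_below_tangent(1)[OF n pos(1) this(1) pos(2) this(2)] False show ?thesis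
      by (simp only: gap_def Gxi_def q_def p if_False nat.simps)
  qed
  have 2: "ln (gap \<eta> i) < ln (gap \<xi> i) + (q i - q (Suc i)) / gap \<xi> i" if "0 < i" "p i \<noteq> p (Suc i)"
  proof -
    have "\<xi> (Suc i) / a i < \<xi> i / a i" "\<eta> (Suc i) / a i < \<eta> i / a i"
      using assms ai Omega_less that by (auto intro!: divide_strict_right_mono)
    from ln_G_diff_below_tangent(2)[OF n pos(1) this(1) pos(2) this(2), unfolded p] that show ?thesis
      by (simp add: gap_def Gxi_def q_def)
  qed
  show "k i * (lev (Suc i) - lev i) * ln (gap \<eta> i) \<le>
      k i * (lev (Suc i) - lev i) * ln (gap \<xi> i) + flux \<xi> i i * p i - flux \<xi> i (Suc i) * p (Suc i)"
    using mult_left_mono[OF 1, of c] c flux unfolding c_def[symmetric] by (simp add: distrib_left)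
  show "k i * (lev (Suc i) - lev i) * ln (gap \<eta> i) <
      k i * (lev (Suc i) - lev i) * ln (gap \<xi> i) + flux \<xi> i i * p i - flux \<xi> i (Suc i) * p (Suc i)"
    if "0 < i" "p i \<noteq> p (Suc i)"
    using mult_strict_left_mono[OF 2[OF that] c] flux unfolding c_def[symmetric] by (simp add: distrib_left)
qed

text \<open>Summation by parts, from phases to radii: radius \<open>i\<close> is the outer end of
  phase \<open>i\<close> and the inner end of phase \<open>i - 1\<close>. Index 0 drops out because
  \<open>flux\<close> is 0 there; the separate term at \<open>m\<close> belongs to the innermost
  phase.\<close>

lemma sum_flux_balance:
  "- (\<Sum>i<m. flux \<xi> i i * p i - flux \<xi> i (Suc i) * p (Suc i)) - flux \<xi> m m * p m
     + (\<Sum>i=1..m. d i / 2 * (\<xi> i)\<^sup>2 * p i) = (\<Sum>i=1..m. balance \<xi> i * p i)"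
proof -
  have "(\<Sum>i<m. flux \<xi> i i * p i) + flux \<xi> m m * p m = (\<Sum>i<Suc m. flux \<xi> i i * p i)"
    by simp
  also have "\<dots> = (\<Sum>i=1..m. flux \<xi> i i * p i)"
    unfolding sum.lessThan_Suc_shift by (simp add: flux_def sum.atLeast1_atMost_eq)
  finally have "(\<Sum>i<m. flux \<xi> i i * p i) + flux \<xi> m m * p m = (\<Sum>i=1..m. flux \<xi> i i * p i)" .
  moreover have "(\<Sum>i<m. flux \<xi> i (Suc i) * p (Suc i)) = (\<Sum>i=1..m. flux \<xi> (i - 1) i * p i)"
    by (simp add: sum.atLeast1_atMost_eq)
  ultimately show ?thesis
    by (simp add: balance_def algebra_simps sum.distrib sum_subtractf)
qed

text \<open>Strict convexity in tau in first-order form, with \<open>balance \<xi>\<close> as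
  gradient. Each term of the energy is compared with its own tangent, and the tangents are regrouped
  by radius.\<close>

lemma energy_above_tangent:
  assumes "\<xi> \<in> Omega m" "\<eta> \<in> Omega m" "\<eta> \<noteq> \<xi>"
  shows "energy \<xi> + (\<Sum>i=1..m. balance \<xi> i * ln (\<eta> i / \<xi> i)) < energy \<eta>"
proof -
  define p where "p j = ln (\<eta> j / \<xi> j)" for j
  define L where "L \<zeta> i = k i * (lev (Suc i) - lev i) * ln (gap \<zeta> i)" for \<zeta> i
  define R where "R i = L \<xi> i + (flux \<xi> i i * p i - flux \<xi> i (Suc i) * p (Suc i))" for i
  have L: "L \<eta> i \<le> R i" if "i < m" for i
    using ln_gap_below_tangent(1)[OF assms(1,2) that] by (simp add: R_def L_def p_def)
  have pos: "0 < \<xi> i" "0 < \<eta> i" if "1 \<le> i" "i \<le> m" for i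
    using that assms Omega_pos by auto
  have kA: "0 < k m * A" using k A by simp
  have xm: "0 < \<xi> m / a m" "0 < \<eta> m / a m" using pos[of m] a[of m] m by auto
  have pm: "ln (\<eta> m / a m / (\<xi> m / a m)) = p m"
    using a[of m] by (simp add: p_def)
  have fm: "flux \<xi> m m = k m * A * wker n (\<xi> m / a m)"
    using m by (simp add: flux_def amp_def)
  have Gm: "k m * A * G n (\<xi> m / a m) - flux \<xi> m m * p m \<le> k m * A * G n (\<eta> m / a m)"
    using mult_left_mono[OF G_above_tangent(1)[OF n xm], of "k m * A"] kA
    by (simp only: pm fm right_diff_distrib mult.assoc less_imp_le)
  have Q: "(\<Sum>i=1..m. d i * (\<xi> i)\<^sup>2) + 4 * (\<Sum>i=1..m. d i / 2 * (\<xi> i)\<^sup>2 * p i) \<le> (\<Sum>i=1..m. d i * (\<eta> i)\<^sup>2)"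
    unfolding sum_distrib_left sum.distrib[symmetric]
  proof (rule sum_mono)
    fix i assume i: "i \<in> {1..m}"
    show "d i * (\<xi> i)\<^sup>2 + 4 * (d i / 2 * (\<xi> i)\<^sup>2 * p i) \<le> d i * (\<eta> i)\<^sup>2"
      using mult_left_mono[OF square_above_tangent[OF pos[of i]], of "d i"] d[of i] i
      by (simp add: p_def algebra_simps)
  qed
  \<comment> \<open>If the innermost radius moves, the \<open>G\<close> term is strict. Otherwise
    \<open>p m = 0\<close>; if all neighbouring displacements agreed, they would all vanish, and
    extensionality would give \<open>\<eta> = \<xi>\<close>.\<close>
  have strict: "(\<Sum>i<m. L \<eta> i) < (\<Sum>i<m. R i) \<or>
      k m * A * G n (\<xi> m / a m) - flux \<xi> m m * p m < k m * A * G n (\<eta> m / a m)"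
  proof (cases "\<eta> m = \<xi> m")
    case False
    then have "G n (\<xi> m / a m) - wker n (\<xi> m / a m) * p m < G n (\<eta> m / a m)"
      using G_above_tangent(2)[OF n xm] pm a[of m] by auto
    from mult_strict_left_mono[OF this kA] show ?thesis
      by (intro disjI2) (simp only: fm right_diff_distrib mult.assoc)
  next
    case True
    have "\<exists>i\<in>{1..<m}. p i \<noteq> p (Suc i)"
    proof (rule ccontr)
      assume "\<not> ?thesis"
      then have step: "p i = p (Suc i)" if "1 \<le> i" "i < m" for i using that by auto
      have "p i = 0" if "1 \<le> i" "i \<le> m" for i
        using that(2,1)
      proof (induction rule: inc_induct)
        case base
        then show ?case using True pos[of m] m by (simp add: p_def)
      next
        case (step i)
        then show ?case using \<open>\<And>i. 1 \<le> i \<Longrightarrow> i < m \<Longrightarrow> p i = p (Suc i)\<close>[of i] by simp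
      qed
      then have "\<eta> i = \<xi> i" if "i \<in> {1..m}" for i
        using that pos[of i] by (force simp: p_def)
      moreover have "\<eta> \<in> extensional {1..m}" "\<xi> \<in> extensional {1..m}"
        using assms by (auto simp: Omega_def)
      ultimately show False
        using assms(3) extensionalityI by blast
    qed
    then obtain i where i: "1 \<le> i" "i < m" "p i \<noteq> p (Suc i)" by auto
    have "(\<Sum>i<m. L \<eta> i) < (\<Sum>i<m. R i)"
    proof (rule sum_strict_mono_ex1)
      show "\<exists>i\<in>{..<m}. L \<eta> i < R i"
        using ln_gap_below_tangent(2)[OF assms(1,2), of i] i
        by (intro bexI[of _ i]) (simp_all add: R_def L_def p_def)
    qed (use L in auto)
    then show ?thesis ..
  qed
  have "(\<Sum>i<m. L \<eta> i) \<le> (\<Sum>i<m. R i)"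
    by (rule sum_mono) (use L in auto)
  then have "(\<Sum>i<m. L \<eta> i) - k m * A * G n (\<eta> m / a m) <
      (\<Sum>i<m. R i) - (k m * A * G n (\<xi> m / a m) - flux \<xi> m m * p m)"
    using strict Gm by linarith
  moreover have "(\<Sum>i<m. R i) = (\<Sum>i<m. L \<xi> i) + (\<Sum>i<m. flux \<xi> i i * p i - flux \<xi> i (Suc i) * p (Suc i))"
    unfolding R_def by (rule sum.distrib)
  ultimately show ?thesis
    using Q sum_flux_balance[of \<xi> p] unfolding energy_eq L_def[symmetric] p_def[symmetric]
    by linarith
qed

section \<open>Partial derivatives of the energy\<close>

lemma DERIV_Gxi_upd:
  assumes "\<xi> \<in> Omega m" "1 \<le> i" "i \<le> m" "j \<le> m"
  shows "((\<lambda>s. Gxi n (a j) (\<xi>(i := s)) l) has_real_derivative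
      (if i = l then - (wker n (\<xi> i / a j) / \<xi> i) else 0)) (at (\<xi> i))"
proof (cases "i = l")
  case True
  have "((\<lambda>s. G n (s / a j)) has_real_derivative - ker n (\<xi> i / a j) * (1 / a j)) (at (\<xi> i))"
    using a[of j] Omega_pos[OF assms(1-3)] assms by (intro DERIV_G_chain) (auto intro!: derivative_eq_intros)
  then show ?thesis
    using True a[of j] Omega_pos[OF assms(1-3)] assms by (simp add: Gxi_def)
qed (cases "l = 0"; simp add: Gxi_def)

lemma DERIV_energy:
  assumes "\<xi> \<in> Omega m" "1 \<le> i" "i \<le> m"
  shows "((\<lambda>s. energy (\<xi>(i := s))) has_real_derivative balance \<xi> i / \<xi> i) (at (\<xi> i))"
proof -
  define h where "h j = wker n (\<xi> i / a j) / \<xi> i" for j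
  define c where "c j = k j * (lev (Suc j) - lev j)" for j
  have xi: "0 < \<xi> i" using Omega_pos assms by simp
  have gap: "((\<lambda>s. c j * ln (gap (\<xi>(i := s)) j)) has_real_derivative
      c j / gap \<xi> j * ((if i = j then h j else 0) - (if i = Suc j then h j else 0))) (at (\<xi> i))"
    if "j < m" for j
  proof -
    have "((\<lambda>s. gap (\<xi>(i := s)) j) has_real_derivative
       (if i = j then h j else 0) - (if i = Suc j then h j else 0)) (at (\<xi> i))"
      unfolding gap_def h_def
      by (rule DERIV_cong[OF DERIV_diff[OF DERIV_Gxi_upd[OF assms] DERIV_Gxi_upd[OF assms]]]) (use that in auto)
    from DERIV_cmult[OF DERIV_chain2[OF DERIV_ln_divide this]] show ?thesis
      using gap_pos[OF assms(1) that] by simp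
  qed
  have top: "((\<lambda>s. k m * A * G n ((\<xi>(i := s)) m / a m)) has_real_derivative
      k m * A * (if i = m then - h m else 0)) (at (\<xi> i))"
  proof -
    have "Gxi n (a m) \<zeta> m = G n (\<zeta> m / a m)" for \<zeta>
      using m by (simp add: Gxi_def)
    with DERIV_cmult[OF DERIV_Gxi_upd[OF assms, of m m], of "k m * A"] show ?thesis
      by (simp only: h_def)
  qed
  have quad: "((\<lambda>s. d j * ((\<xi>(i := s)) j)\<^sup>2) has_real_derivative (if j = i then 2 * d i * \<xi> i else 0)) (at (\<xi> i))" for j
    by (auto intro!: derivative_eq_intros)
  have "((\<lambda>s. energy (\<xi>(i := s))) has_real_derivative
      - (\<Sum>j<m. c j / gap \<xi> j * ((if i = j then h j else 0) - (if i = Suc j then h j else 0)))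
      + k m * A * (if i = m then - h m else 0) + 1 / 4 * (\<Sum>j=1..m. if j = i then 2 * d i * \<xi> i else 0)) (at (\<xi> i))"
    unfolding energy_eq c_def[symmetric]
    by (intro DERIV_add DERIV_minus DERIV_sum DERIV_cmult gap top quad) auto
  \<comment> \<open>The indicators select the two phases meeting at radius \<open>i\<close>. Phase
    \<open>i\<close> is in this sum only if \<open>i < m\<close>; for \<open>i = m\<close> its part
    is played by the term \<open>k m * A * G\<close>.\<close>
  moreover have "(\<Sum>j<m. c j / gap \<xi> j * ((if i = j then h j else 0) - (if i = Suc j then h j else 0)))
      = (if i < m then flux \<xi> i i / \<xi> i else 0) - flux \<xi> (i - 1) i / \<xi> i"
  proof -
    have "(\<Sum>j<m. c j / gap \<xi> j * ((if i = j then h j else 0) - (if i = Suc j then h j else 0)))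
       = (\<Sum>j<m. if j = i then c j / gap \<xi> j * h j else 0) - (\<Sum>j<m. if j = i - 1 then c j / gap \<xi> j * h j else 0)"
      unfolding sum_subtractf[symmetric] using assms(2) by (intro sum.cong) auto
    also have "\<dots> = (if i < m then c i / gap \<xi> i * h i else 0) - c (i - 1) / gap \<xi> (i - 1) * h (i - 1)"
      using assms by simp
    also have "c (i - 1) / gap \<xi> (i - 1) * h (i - 1) = flux \<xi> (i - 1) i / \<xi> i"
    proof -
      have "i - 1 < m" "Suc (i - 1) = i" using assms by auto
      then show ?thesis using assms(2) by (simp add: flux_def amp_def c_def h_def mult_ac)
    qed
    also have "(if i < m then c i / gap \<xi> i * h i else 0) = (if i < m then flux \<xi> i i / \<xi> i else 0)"
      using assms by (simp add: flux_def amp_def c_def h_def mult_ac)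
    finally show ?thesis .
  qed
  moreover have "k m * A * (if i = m then - h m else 0) = (if i < m then 0 else - (flux \<xi> i i / \<xi> i))"
    using assms m by (auto simp: flux_def amp_def h_def)
  moreover have "1 / 4 * (\<Sum>j=1..m. if j = i then 2 * d i * \<xi> i else 0) = d i / 2 * (\<xi> i)\<^sup>2 / \<xi> i"
    using assms xi by (simp add: power2_eq_square)
  ultimately show ?thesis
    by (simp add: balance_def add_divide_distrib diff_divide_distrib split: if_splits)
qed

lemma critical_point_iff_balance:
  assumes "\<xi> \<in> Omega m"
  shows "critical_point m energy \<xi> \<longleftrightarrow> (\<forall>i\<in>{1..m}. balance \<xi> i = 0)"
proof -
  have "((\<lambda>s. energy (\<xi>(i := s))) has_real_derivative 0) (at (\<xi> i)) \<longleftrightarrow> balance \<xi> i = 0"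
    if "i \<in> {1..m}" for i
  proof -
    have "balance \<xi> i / \<xi> i = 0 \<longleftrightarrow> balance \<xi> i = 0"
      using Omega_pos[OF assms, of i] that by auto
    then show ?thesis
      using DERIV_energy[OF assms, of i] DERIV_unique that by fastforce
  qed
  then show ?thesis by (simp add: critical_point_def)
qed

lemma balance_zero_imp_strict_min:
  assumes "\<xi> \<in> Omega m" "\<And>i. i \<in> {1..m} \<Longrightarrow> balance \<xi> i = 0" "\<eta> \<in> Omega m" "\<eta> \<noteq> \<xi>"
  shows "energy \<xi> < energy \<eta>"
  using energy_above_tangent[OF assms(1,3,4)] assms(2) by simp

end


subsection \<open>Existence of a minimizer\<close>

lemma affine_minus_ln_at_top:
  fixes B C D :: real
  assumes "0 < D"
  shows "filterlim (\<lambda>g. B - C * ln g + D * g) at_top at_top"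
proof -
  have "((\<lambda>g::real. D - C * (ln g / g)) \<longlongrightarrow> D - C * 0) at_top"
    by (intro tendsto_intros ln_x_over_x_tendsto_0)
  then have "filterlim (\<lambda>g. (D - C * (ln g / g)) * g) at_top at_top"
    using assms by (intro filterlim_tendsto_pos_mult_at_top[where c = D] filterlim_ident) auto
  then have "filterlim (\<lambda>g. B + (D - C * (ln g / g)) * g) at_top at_top"
    by (rule filterlim_tendsto_add_at_top[OF tendsto_const])
  moreover have "\<forall>\<^sub>F g::real in at_top. B + (D - C * (ln g / g)) * g \<le> B - C * ln g + D * g"
    using eventually_gt_at_top[of 0] by eventually_elim (simp add: field_simps)
  ultimately show ?thesis
    by (rule filterlim_at_top_mono)
qed

context stefan
begin

lemma weight_pos: "i < m \<Longrightarrow> 0 < k i * (lev (Suc i) - lev i)"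
  using k[of i] lev[of i] by simp

lemma ln_gap_le:
  assumes "\<xi> \<in> Omega m" "i < m" "0 < y" "y \<le> \<xi> m"
  shows "ln (gap \<xi> i) \<le> ln (G n (y / a i))"
proof -
  have ai: "0 < a i" using a assms by simp
  have "\<xi> m \<le> \<xi> (Suc i)"
    using Omega_less[OF assms(1), of "Suc i" m] assms(2) by (cases "Suc i = m") auto
  then have "y / a i \<le> \<xi> (Suc i) / a i"
    using ai assms by (intro divide_right_mono) auto
  then have "G n (\<xi> (Suc i) / a i) \<le> G n (y / a i)"
    using G_strict_antimono[of "y / a i" "\<xi> (Suc i) / a i" n] assms ai by (cases "y / a i = \<xi> (Suc i) / a i") auto
  moreover have "gap \<xi> i \<le> G n (\<xi> (Suc i) / a i)"
    using G_nonneg[of "\<xi> i / a i" n] Omega_pos[OF assms(1), of i] ai assms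
    by (auto simp: gap_def Gxi_def)
  ultimately show ?thesis
    using gap_pos[OF assms(1,2)] by (subst ln_le_cancel_iff) auto
qed

lemma energy_ge:
  assumes "\<xi> \<in> Omega m"
  shows "k m * A * G n (\<xi> m / a m) - (\<Sum>i<m. k i * (lev (Suc i) - lev i) * ln (gap \<xi> i)) \<le> energy \<xi>"
proof -
  have "0 \<le> (\<Sum>i=1..m. d i * (\<xi> i)\<^sup>2)"
    using d by (intro sum_nonneg mult_nonneg_nonneg) auto
  then show ?thesis by (simp add: energy_eq)
qed

text \<open>As \<open>\<xi> m\<close> tends to \<open>0\<close>, \<open>k m * A * G n (\<xi> m / a m)\<close> tends to infinity and beats
  the logarithms, since each \<open>G n (\<xi> m / a i)\<close> is at most a multiple of \<open>G n (\<xi> m / a m)\<close>.\<close>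

lemma sublevel_innermost_ge:
  obtains \<epsilon> where "0 < \<epsilon>" "\<And>\<xi>. \<xi> \<in> Omega m \<Longrightarrow> energy \<xi> \<le> M \<Longrightarrow> \<epsilon> \<le> \<xi> m"
proof -
  define c where "c i = k i * (lev (Suc i) - lev i)" for i
  define b where "b i = a m / a i" for i
  \<comment> \<open>\<open>G_scale_le\<close> leaves the additive constant \<open>G n (b i)\<close>;
    once \<open>1 \<le> G n y\<close> it is absorbed into the factor.\<close>
  define K where "K i = exp (1 / 4) * b i powi (2 - int n) + G n (b i)" for i
  have am: "0 < a m" using a by simp
  have b: "0 < b i" if "i < m" for i using a that am by (simp add: b_def)
  have K: "0 < K i" if "i < m" for i
    using b[OF that] G_pos[OF b[OF that], of n] by (simp add: K_def add_pos_pos)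
  define low where "low g = - (\<Sum>i<m. c i * ln (K i)) - (\<Sum>i<m. c i) * ln g + k m * A * g" for g
  have "filterlim low at_top at_top"
    unfolding low_def by (rule affine_minus_ln_at_top) (use k A in simp)
  then have "filterlim (\<lambda>y. low (G n y)) at_top (at_right 0)"
    by (rule filterlim_compose) (rule filterlim_G_at_top[OF n])
  then have "\<forall>\<^sub>F y in at_right 0. M < low (G n y)"
    by (simp add: filterlim_at_top_dense)
  moreover have "\<forall>\<^sub>F y in at_right 0. 1 \<le> G n y"
    using filterlim_G_at_top[OF n] by (simp add: filterlim_at_top)
  moreover have "\<forall>\<^sub>F y::real in at_right 0. y \<le> 1"
    unfolding eventually_at_right_field by (intro exI[of _ 1]) auto
  ultimately have "\<forall>\<^sub>F y in at_right 0. M < low (G n y) \<and> 1 \<le> G n y \<and> y \<le> 1"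
    by eventually_elim simp
  then obtain e where e: "0 < e"
    "\<And>y. 0 < y \<Longrightarrow> y < e \<Longrightarrow> M < low (G n y) \<and> 1 \<le> G n y \<and> y \<le> 1"
    unfolding eventually_at_right_field by auto
  show thesis
  proof (rule that[of "a m * e"])
    show "0 < a m * e" using am e by simp
    fix \<xi> assume \<xi>: "\<xi> \<in> Omega m" "energy \<xi> \<le> M"
    show "a m * e \<le> \<xi> m"
    proof (rule ccontr)
      assume less: "\<not> a m * e \<le> \<xi> m"
      define y where "y = \<xi> m / a m"
      have pos: "0 < \<xi> m" using Omega_pos[OF \<xi>(1)] m by simp
      have y: "0 < y" "y < e"
        using pos am less by (auto simp: y_def field_simps)
      have ln_gap: "c i * ln (gap \<xi> i) \<le> c i * ln (K i) + c i * ln (G n y)" if "i < m" for i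
      proof -
        have "G n (b i * y) \<le> exp (1 / 4) * b i powi (2 - int n) * G n y + G n (b i) * 1"
          using G_scale_le[OF n b[OF that] y(1)] e(2)[OF y] by simp
        also have "\<dots> \<le> K i * G n y"
          unfolding K_def distrib_right
          using e(2)[OF y] G_pos[OF b[OF that], of n] by (intro add_left_mono mult_left_mono) auto
        finally have "ln (G n (b i * y)) \<le> ln (K i * G n y)"
          using G_pos[of "b i * y" n] b[OF that] y by simp
        also have "\<dots> = ln (K i) + ln (G n y)"
          using K[OF that] e(2)[OF y] by (simp add: ln_mult)
        finally have "ln (gap \<xi> i) \<le> ln (K i) + ln (G n y)"
          using ln_gap_le[OF \<xi>(1) that pos order_refl] am by (simp add: b_def y_def)
        then have "c i * ln (gap \<xi> i) \<le> c i * (ln (K i) + ln (G n y))"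
          using weight_pos[OF that] by (intro mult_left_mono) (auto simp: c_def)
        then show ?thesis by (simp add: distrib_left)
      qed
      have "(\<Sum>i<m. c i * ln (gap \<xi> i)) \<le> (\<Sum>i<m. c i * ln (K i) + c i * ln (G n y))"
        by (rule sum_mono) (use ln_gap in simp)
      then have "low (G n y) \<le> energy \<xi>"
        using energy_ge[OF \<xi>(1)]
        by (simp add: low_def c_def y_def sum.distrib sum_distrib_right)
      then show False using e(2)[OF y] \<xi>(2) by simp
    qed
  qed
qed

text \<open>Once \<open>\<epsilon> \<le> \<xi> m\<close>, all logarithms are bounded above, so
  bounded energy keeps each of them from going to minus infinity. The \<open>\<delta>\<close> solves
  \<open>c i * ln \<delta> = - (M + S)\<close>.\<close>

lemma sublevel_gap_ge:
  assumes "i < m" "0 < \<epsilon>"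
  obtains \<delta> where "0 < \<delta>"
    "\<And>\<xi>. \<xi> \<in> Omega m \<Longrightarrow> energy \<xi> \<le> M \<Longrightarrow> \<epsilon> \<le> \<xi> m \<Longrightarrow> \<delta> \<le> gap \<xi> i"
proof -
  define c where "c j = k j * (lev (Suc j) - lev j)" for j
  define S where "S = (\<Sum>j<m. c j * \<bar>ln (G n (\<epsilon> / a j))\<bar>)"
  have c: "0 < c j" if "j < m" for j using weight_pos[OF that] by (simp add: c_def)
  show thesis
  proof (rule that[of "exp (- (M + S) / c i)"])
    fix \<xi> assume \<xi>: "\<xi> \<in> Omega m" "energy \<xi> \<le> M" "\<epsilon> \<le> \<xi> m"
    have le: "c j * ln (gap \<xi> j) \<le> c j * \<bar>ln (G n (\<epsilon> / a j))\<bar>" if "j < m" for j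
      using ln_gap_le[OF \<xi>(1) that assms(2) \<xi>(3)] c[OF that] by (intro mult_left_mono) auto
    have "0 \<le> c i * \<bar>ln (G n (\<epsilon> / a i))\<bar>"
      using c[OF assms(1)] by simp
    moreover have "(\<Sum>j\<in>{..<m} - {i}. c j * ln (gap \<xi> j)) \<le> (\<Sum>j\<in>{..<m} - {i}. c j * \<bar>ln (G n (\<epsilon> / a j))\<bar>)"
      by (rule sum_mono) (use le in auto)
    ultimately have "(\<Sum>j<m. c j * ln (gap \<xi> j)) \<le> c i * ln (gap \<xi> i) + S"
      using sum.remove[of "{..<m}" i "\<lambda>j. c j * ln (gap \<xi> j)"]
        sum.remove[of "{..<m}" i "\<lambda>j. c j * \<bar>ln (G n (\<epsilon> / a j))\<bar>"] assms(1)
      by (simp add: S_def)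
    moreover have "0 \<le> k m * A * G n (\<xi> m / a m)"
      using k[of m] A a[of m] Omega_pos[OF \<xi>(1) m order_refl] G_nonneg[of "\<xi> m / a m" n] by simp
    ultimately have "- (M + S) \<le> ln (gap \<xi> i) * c i"
      using energy_ge[OF \<xi>(1)] \<xi>(2) by (simp add: c_def mult.commute)
    then have "- (M + S) / c i \<le> ln (gap \<xi> i)"
      using c[OF assms(1)] by (simp add: pos_divide_le_eq)
    then show "exp (- (M + S) / c i) \<le> gap \<xi> i"
      using gap_pos[OF \<xi>(1) assms(1)] by (simp add: ln_ge_iff)
  qed simp
qed

text \<open>\<open>gap \<xi> 0\<close> is just \<open>G n (\<xi> 1 / a 0)\<close>, which is small
  when the outermost radius is large.\<close>

lemma sublevel_outermost_le:
  assumes "0 < \<delta>"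
  obtains R where "\<And>\<xi>. \<xi> \<in> Omega m \<Longrightarrow> \<delta> \<le> gap \<xi> 0 \<Longrightarrow> \<xi> 1 \<le> R"
proof -
  have a0: "0 < a 0" using a by simp
  have "\<forall>\<^sub>F y in at_top. G n y < \<delta>"
    using order_tendstoD(2)[OF G_tendsto_0 assms] .
  then obtain N where N: "\<And>y. N \<le> y \<Longrightarrow> G n y < \<delta>"
    unfolding eventually_at_top_linorder by auto
  show thesis
  proof (rule that[of "a 0 * N"])
    fix \<xi> assume "\<xi> \<in> Omega m" "\<delta> \<le> gap \<xi> 0"
    then have "\<not> N \<le> \<xi> 1 / a 0"
      using N[of "\<xi> 1 / a 0"] by (auto simp: gap_def Gxi_def)
    then show "\<xi> 1 \<le> a 0 * N"
      using a0 by (simp add: field_simps)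
  qed
qed

text \<open>Only positivity of the coordinates is assumed, not their order, because the gaps are
  also needed on a box that may leave \<open>Omega m\<close>.\<close>

lemma continuous_on_gap:
  assumes "\<And>\<xi> j. \<xi> \<in> S \<Longrightarrow> 1 \<le> j \<Longrightarrow> j \<le> m \<Longrightarrow> 0 < \<xi> j" "i < m"
  shows "continuous_on S (\<lambda>\<xi>. gap \<xi> i)"
proof -
  have "continuous_on S (\<lambda>\<xi>. Gxi n (a i) \<xi> j)" if "j \<le> m" for j
  proof (cases "j = 0")
    case False
    have "continuous_on S (\<lambda>\<xi>. \<xi> j)"
      by (rule continuous_on_subset[OF continuous_on_product_coordinates]) simp
    then have "continuous_on S (\<lambda>\<xi>. G n (\<xi> j / a i))"
      using assms a[of i] that False
      by (intro continuous_on_compose2[OF continuous_on_G] continuous_intros) auto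
    then show ?thesis using False by (simp add: Gxi_def)
  qed (simp add: Gxi_def)
  then show ?thesis
    using assms(2) unfolding gap_def by (intro continuous_on_diff) auto
qed

lemma continuous_on_energy:
  assumes "S \<subseteq> Omega m"
  shows "continuous_on S energy"
proof -
  have pos: "0 < \<xi> j" if "\<xi> \<in> S" "1 \<le> j" "j \<le> m" for \<xi> j
    using that assms Omega_pos by blast
  have coord: "continuous_on S (\<lambda>\<xi>. \<xi> j)" for j
    by (rule continuous_on_subset[OF continuous_on_product_coordinates]) simp
  have "continuous_on S (\<lambda>\<xi>. G n (\<xi> m / a m))"
    using pos m a[of m] coord by (intro continuous_on_compose2[OF continuous_on_G] continuous_intros) auto
  moreover have "continuous_on S (\<lambda>\<xi>. ln (gap \<xi> i))" if "i < m" for i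
  proof (intro continuous_on_ln continuous_on_gap pos ballI that)
    show "gap \<xi> i \<noteq> 0" if "\<xi> \<in> S" for \<xi>
      using gap_pos[of \<xi> i] assms that \<open>i < m\<close> by auto
  qed
  ultimately show ?thesis
    unfolding energy_eq
    by (intro continuous_on_add continuous_on_minus continuous_on_mult continuous_on_const
          continuous_on_sum continuous_on_power coord) auto
qed

text \<open>The strict inequalities of \<open>Omega m\<close> are not closed. They are replaced by
  closed conditions that imply them, radii in \<open>{\<epsilon>..R}\<close> and gaps at least
  \<open>\<delta> i > 0\<close>, which still hold on the whole sublevel set of a reference
  point.\<close>

lemma energy_attains_min:
  obtains \<xi> where "\<xi> \<in> Omega m" "\<And>\<eta>. \<eta> \<in> Omega m \<Longrightarrow> energy \<xi> \<le> energy \<eta>"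
proof -
  define \<xi>0 where "\<xi>0 = restrict (\<lambda>i. real (Suc m - i)) {1..m}"
  have \<xi>0: "\<xi>0 \<in> Omega m"
    using m by (auto simp: \<xi>0_def Omega_def)
  define M where "M = energy \<xi>0"
  obtain \<epsilon> where \<epsilon>: "0 < \<epsilon>" "\<And>\<xi>. \<xi> \<in> Omega m \<Longrightarrow> energy \<xi> \<le> M \<Longrightarrow> \<epsilon> \<le> \<xi> m"
    using sublevel_innermost_ge[of M] by blast
  have "\<exists>\<delta>>0. \<forall>\<xi>\<in>Omega m. energy \<xi> \<le> M \<longrightarrow> \<delta> \<le> gap \<xi> i" if "i < m" for i
    using sublevel_gap_ge[OF that \<epsilon>(1), of M] \<epsilon>(2) by metis
  then obtain \<delta> where \<delta>: "\<And>i. i < m \<Longrightarrow> 0 < \<delta> i"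
    "\<And>i \<xi>. i < m \<Longrightarrow> \<xi> \<in> Omega m \<Longrightarrow> energy \<xi> \<le> M \<Longrightarrow> \<delta> i \<le> gap \<xi> i"
    by metis
  obtain R where R: "\<And>\<xi>. \<xi> \<in> Omega m \<Longrightarrow> \<delta> 0 \<le> gap \<xi> 0 \<Longrightarrow> \<xi> 1 \<le> R"
    using sublevel_outermost_le[of "\<delta> 0"] \<delta>(1)[of 0] m by auto
  \<comment> \<open>Pinning the coordinates outside \<open>{1..m}\<close> to
    \<open>undefined\<close> yields both extensionality and compact factors for Tychonoff's
    theorem.\<close>
  define box where "box = PiE UNIV (\<lambda>i. if i \<in> {1..m} then {\<epsilon>..R} else {undefined::real})"
  define C where "C = box \<inter> (\<Inter>i<m. box \<inter> (\<lambda>\<xi>. gap \<xi> i) -` {\<delta> i..})"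
  have "compactin euclidean box"
    unfolding box_def euclidean_product_topology[symmetric]
    by (subst compactin_PiE) auto
  then have box: "compact box" by simp
  have box_pos: "0 < \<xi> j" if "\<xi> \<in> box" "1 \<le> j" "j \<le> m" for \<xi> j
  proof -
    have "\<xi> j \<in> {\<epsilon>..R}" using that by (auto simp: box_def PiE_iff split: if_splits)
    then show ?thesis using \<epsilon>(1) by simp
  qed
  have "compact C"
    unfolding C_def
    by (intro compact_Int_closed[OF box] closed_INT ballI continuous_closed_preimage
          continuous_on_gap compact_imp_closed[OF box]) (use box_pos in auto)
  moreover have C_Omega: "C \<subseteq> Omega m"
  proof
    fix \<xi> assume \<xi>: "\<xi> \<in> C"
    then have mem: "\<xi> \<in> box" by (simp add: C_def)
    \<comment> \<open>Radii out of order would make the gap nonpositive, as \<open>G\<close>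
      decreases.\<close>
    have "\<xi> (Suc i) < \<xi> i" if i: "i \<in> {1..<m}" for i
    proof (rule ccontr)
      assume le: "\<not> \<xi> (Suc i) < \<xi> i"
      have ai: "0 < a i" using a i by simp
      have "\<delta> i \<le> gap \<xi> i" using \<xi> i by (auto simp: C_def split: if_splits)
      then have "0 < gap \<xi> i" using \<delta>(1)[of i] i by simp
      moreover have "0 < \<xi> i / a i" using box_pos[OF mem, of i] i ai by simp
      moreover have "\<xi> i / a i \<le> \<xi> (Suc i) / a i"
        using le ai by (intro divide_right_mono) auto
      ultimately show False
        using G_strict_antimono[of "\<xi> i / a i" "\<xi> (Suc i) / a i" n] i
        by (cases "\<xi> i / a i = \<xi> (Suc i) / a i") (auto simp: gap_def Gxi_def)
    qed
    moreover have "\<xi> \<in> extensional {1..m}"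
      using mem by (auto simp: box_def PiE_iff extensional_def split: if_splits)
    ultimately show "\<xi> \<in> Omega m"
      using box_pos[OF mem m] by (simp add: Omega_def)
  qed
  moreover have sublevel: "\<xi> \<in> C" if sub: "\<xi> \<in> Omega m" "energy \<xi> \<le> M" for \<xi>
  proof -
    have "\<epsilon> \<le> \<xi> i \<and> \<xi> i \<le> R" if i: "i \<in> {1..m}" for i
    proof -
      have "\<xi> m \<le> \<xi> i"
        using Omega_less[OF sub(1), of i m] i by (cases "i = m") auto
      moreover have "\<xi> i \<le> \<xi> 1"
        using Omega_less[OF sub(1), of 1 i] i by (cases "i = 1") auto
      ultimately show ?thesis
        using \<epsilon>(2)[OF sub] R[OF sub(1)] \<delta>(2)[OF _ sub, of 0] m by force
    qed
    moreover have "\<xi> \<in> extensional {1..m}"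
      using sub(1) by (simp add: Omega_def)
    ultimately have "\<xi> \<in> box"
      by (auto simp: box_def extensional_def)
    then show ?thesis using \<delta>(2)[OF _ sub] by (auto simp: C_def)
  qed
  moreover have "\<xi>0 \<in> C"
    using sublevel \<xi>0 by (simp add: M_def)
  ultimately obtain \<xi> where \<xi>: "\<xi> \<in> C" "\<And>\<eta>. \<eta> \<in> C \<Longrightarrow> energy \<xi> \<le> energy \<eta>"
    using continuous_attains_inf[of C energy] continuous_on_energy by blast
  show thesis
  proof (rule that)
    show "\<xi> \<in> Omega m" using \<xi> C_Omega by auto
    fix \<eta> assume "\<eta> \<in> Omega m"
    then show "energy \<xi> \<le> energy \<eta>"
      using \<xi>(2)[of \<eta>] \<xi>(2)[OF \<open>\<xi>0 \<in> C\<close>] sublevel[of \<eta>] by (force simp: M_def)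
  qed
qed

text \<open>Openness in one coordinate, enough for Fermat's rule; extensionality keeps
  \<open>Omega m\<close> from being open in the function space.\<close>

lemma Omega_upd:
  assumes "\<xi> \<in> Omega m" "1 \<le> i" "i \<le> m"
  obtains e where "0 < e" "\<And>s. \<bar>\<xi> i - s\<bar> < e \<Longrightarrow> \<xi>(i := s) \<in> Omega m"
proof -
  \<comment> \<open>The distance to the neighbouring radii, with 0 as inner neighbour of the last
    radius and an arbitrary 1 where there is no outer neighbour.\<close>
  define e where "e = min (if i < m then \<xi> i - \<xi> (Suc i) else \<xi> i) (if 1 < i then \<xi> (i - 1) - \<xi> i else 1)"
  have "0 < e"
    using Omega_pos[OF assms] Omega_less[OF assms(1), of i "Suc i"] Omega_less[OF assms(1), of "i - 1" i] assms
    by (auto simp: e_def)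
  moreover have "\<xi>(i := s) \<in> Omega m" if s: "\<bar>\<xi> i - s\<bar> < e" for s
  proof -
    have lo: "(if i < m then \<xi> (Suc i) else 0) < s" and hi: "1 < i \<Longrightarrow> s < \<xi> (i - 1)"
      using s by (auto simp: e_def split: if_splits)
    have "(\<xi>(i := s)) (Suc j) < (\<xi>(i := s)) j" if j: "j \<in> {1..<m}" for j
    proof -
      consider "j = i" | "Suc j = i" | "j \<noteq> i" "Suc j \<noteq> i" by blast
      then show ?thesis
      proof cases
        case 1
        then show ?thesis using lo j by simp
      next
        case 2
        then show ?thesis using hi j by auto
      next
        case 3
        then show ?thesis using assms(1) j by (simp add: Omega_def)
      qed
    qed
    moreover have "0 < (\<xi>(i := s)) m"
      using lo assms Omega_pos[OF assms(1) m order_refl] by auto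
    moreover have "\<xi>(i := s) \<in> extensional {1..m}"
      using assms by (auto simp: Omega_def extensional_def)
    ultimately show ?thesis by (simp add: Omega_def)
  qed
  ultimately show thesis by (rule that)
qed

lemma min_imp_balance_zero:
  assumes "\<xi> \<in> Omega m" "\<And>\<eta>. \<eta> \<in> Omega m \<Longrightarrow> energy \<xi> \<le> energy \<eta>" "i \<in> {1..m}"
  shows "balance \<xi> i = 0"
proof -
  have i: "1 \<le> i" "i \<le> m" using assms by auto
  obtain e where e: "0 < e" "\<And>s. \<bar>\<xi> i - s\<bar> < e \<Longrightarrow> \<xi>(i := s) \<in> Omega m"
    using Omega_upd[OF assms(1) i] by blast
  have "balance \<xi> i / \<xi> i = 0"
    by (rule DERIV_local_min[OF DERIV_energy[OF assms(1) i] e(1)]) (use e assms(2) in auto)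
  then show ?thesis using Omega_pos[OF assms(1) i] by simp
qed

end


subsection \<open>From the Stefan conditions to critical points\<close>

text \<open>The limit of the gradients can be taken along the ray through \<open>e\<close>, where
  the chain rule identifies its component along \<open>e\<close> with the radial derivative. The
  filter \<open>F\<close> covers both one-sided approaches.\<close>

lemma grad_limit_radial:
  fixes u :: "real \<Rightarrow> real^'n \<Rightarrow> real"
  assumes lim: "grad_limit u Q (t, \<rho> *\<^sub>R e) p" and e: "norm e = 1"
    and F: "F \<noteq> bot" "F \<le> at \<rho>"
    and Q: "\<forall>\<^sub>F r in F. (t, r *\<^sub>R e) \<in> Q"
    and f': "\<forall>\<^sub>F r in F. ((\<lambda>r. u t (r *\<^sub>R e)) has_real_derivative f' r) (at r)"
    and L: "(f' \<longlongrightarrow> L) F"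
  shows "p \<bullet> e = L"
proof -
  obtain g where g: "\<And>s x. (s, x) \<in> Q \<Longrightarrow> GDERIV (u s) x :> g (s, x)"
    and g_lim: "(g \<longlongrightarrow> p) (at (t, \<rho> *\<^sub>R e) within Q)"
    using lim by (auto simp: grad_limit_def)
  have ne: "\<forall>\<^sub>F r in F. r \<noteq> \<rho>"
    using F(2) by (auto simp: le_filter_def eventually_at_filter)
  have id: "((\<lambda>r. r) \<longlongrightarrow> \<rho>) F"
    by (rule tendsto_mono[OF F(2)]) (rule tendsto_ident_at)
  have "filterlim (\<lambda>r. (t, r *\<^sub>R e)) (at (t, \<rho> *\<^sub>R e) within Q) F"
    unfolding filterlim_at
  proof
    show "\<forall>\<^sub>F r in F. (t, r *\<^sub>R e) \<in> Q \<and> (t, r *\<^sub>R e) \<noteq> (t, \<rho> *\<^sub>R e)"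
      using Q ne by eventually_elim (use e in auto)
    show "((\<lambda>r. (t, r *\<^sub>R e)) \<longlongrightarrow> (t, \<rho> *\<^sub>R e)) F"
      by (intro tendsto_intros id)
  qed
  then have "((\<lambda>r. g (t, r *\<^sub>R e)) \<longlongrightarrow> p) F"
    by (rule filterlim_compose[OF g_lim])
  then have "((\<lambda>r. g (t, r *\<^sub>R e) \<bullet> e) \<longlongrightarrow> p \<bullet> e) F"
    by (intro tendsto_intros)
  moreover have "\<forall>\<^sub>F r in F. g (t, r *\<^sub>R e) \<bullet> e = f' r"
    using Q f'
  proof eventually_elim
    case (elim r)
    have "(u t has_derivative (\<lambda>h. h \<bullet> g (t, r *\<^sub>R e))) (at (r *\<^sub>R e))"
      using g[OF elim(1)] by (simp add: gderiv_def)
    moreover have "((\<lambda>r. r *\<^sub>R e) has_derivative (\<lambda>h. h *\<^sub>R e)) (at r)"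
      by (auto intro!: derivative_eq_intros)
    ultimately have "((\<lambda>r. u t (r *\<^sub>R e)) has_derivative (\<lambda>h. (h *\<^sub>R e) \<bullet> g (t, r *\<^sub>R e))) (at r)"
      by (rule has_derivative_compose[rotated])
    then have "((\<lambda>r. u t (r *\<^sub>R e)) has_real_derivative (g (t, r *\<^sub>R e) \<bullet> e)) (at r)"
      by (simp add: has_field_derivative_def inner_commute mult_commute_abs)
    then show ?case using elim(2) DERIV_unique by blast
  qed
  ultimately have "(f' \<longlongrightarrow> p \<bullet> e) F"
    using tendsto_cong by force
  then show ?thesis
    using tendsto_unique[OF F(1)] L by blast
qed

text \<open>The defining function is \<open>c * sqrt s - norm y\<close>, positive on the inner side,
  which is the warmer one.\<close>

lemma normal_parabolic_cone:
  fixes S N Q W :: "(real \<times> (real^'n)) set" and x :: "real^'n"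
  assumes W: "open W" "(t, x) \<in> W" "\<And>s y. (s, y) \<in> W \<Longrightarrow> 0 < s \<and> y \<noteq> 0"
    and S: "\<And>s y. (s, y) \<in> W \<Longrightarrow> (s, y) \<in> S \<longleftrightarrow> norm y = c * sqrt s"
    and N: "\<And>s y. (s, y) \<in> W \<Longrightarrow> (s, y) \<in> N \<longleftrightarrow> c * sqrt s < norm y"
    and Q: "\<And>s y. (s, y) \<in> W \<Longrightarrow> (s, y) \<in> Q \<longleftrightarrow> norm y < c * sqrt s"
    and x: "norm x = c * sqrt t"
  shows "normal_from_to S N Q (t, x) (c / (2 * sqrt t), - sgn x)"
proof -
  define \<phi> where "\<phi> P = c * sqrt (fst P) - norm (snd P)" for P :: "real \<times> (real^'n)"
  define D where "D P = (c / (2 * sqrt (fst P)), - sgn (snd P))" for P :: "real \<times> (real^'n)"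
  have "continuous_on W D"
    unfolding D_def using W(3) by (intro continuous_intros) force+
  moreover have "GDERIV \<phi> R :> D R" if R: "R \<in> W" for R
  proof -
    have pos: "0 < fst R" "snd R \<noteq> 0" using W(3)[of "fst R" "snd R"] R by auto
    have "((\<lambda>P. norm (snd P)) has_derivative (\<lambda>h. snd h \<bullet> sgn (snd R))) (at R)"
      by (rule has_derivative_compose[OF has_derivative_snd[OF has_derivative_ident] has_derivative_norm]) (rule pos)
    moreover have "((\<lambda>P. sqrt (fst P)) has_derivative (\<lambda>h. fst h * (1 / (2 * sqrt (fst R))))) (at R)"
      using has_derivative_compose[OF has_derivative_fst[OF has_derivative_ident]
          DERIV_real_sqrt[OF pos(1), unfolded has_field_derivative_def]]
      by (simp add: field_simps)
    ultimately have "(\<phi> has_derivative (\<lambda>h. c * (fst h * (1 / (2 * sqrt (fst R)))) - snd h \<bullet> sgn (snd R))) (at R)"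
      unfolding \<phi>_def[abs_def] by (intro has_derivative_diff has_derivative_mult_right)
    then show ?thesis
      by (simp add: gderiv_def D_def inner_prod_def mult_ac)
  qed
  moreover have "(\<phi> R = 0 \<longleftrightarrow> R \<in> S) \<and> (\<phi> R < 0 \<longleftrightarrow> R \<in> N) \<and> (0 < \<phi> R \<longleftrightarrow> R \<in> Q)" if "R \<in> W" for R
    using S[of "fst R" "snd R"] N[of "fst R" "snd R"] Q[of "fst R" "snd R"] that by (auto simp: \<phi>_def)
  moreover have "(c / (2 * sqrt t), - sgn x) \<noteq> 0" "(t, x) \<in> S"
    using W x S[OF W(2)] by (auto simp: prod_eq_iff sgn_zero_iff)
  moreover have "D (t, x) = (c / (2 * sqrt t), - sgn x)" by (simp add: D_def)
  ultimately show ?thesis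
    unfolding normal_from_to_def using W(1,2) by blast
qed

context stefan
begin

text \<open>The range of the similarity variable \<open>norm x / sqrt t\<close> in phase
  \<open>i\<close>: down to 0 for \<open>i = m\<close>, unbounded above for
  \<open>i = 0\<close>.\<close>

definition zone :: "(nat \<Rightarrow> real) \<Rightarrow> nat \<Rightarrow> real set" where
  "zone \<xi> i = {s. 0 < s \<and> (i < m \<longrightarrow> \<xi> (Suc i) < s) \<and> (0 < i \<longrightarrow> s < \<xi> i)}"

lemma open_zone: "open (zone \<xi> i)"
proof -
  have "zone \<xi> i = {0<..} \<inter> (if i < m then {\<xi> (Suc i)<..} else UNIV) \<inter> (if 0 < i then {..<\<xi> i} else UNIV)"
    by (auto simp: zone_def)
  then show ?thesis by (simp only:) (simp add: open_Int)
qed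

lemma profile_zone:
  assumes "profile n m lev a A \<xi> v" "i \<le> m" "s \<in> zone \<xi> i"
  shows "v s = lev i + amp \<xi> i * (G n (s / a i) - Gxi n (a i) \<xi> i)"
proof (cases "i < m")
  case True
  then show ?thesis
    using assms by (auto simp: profile_def zone_def amp_def gap_def)
next
  case False
  then have "i = m" using assms by simp
  then show ?thesis
    using assms m by (auto simp: profile_def zone_def amp_def Gxi_def)
qed

lemma profile_zone_bounds:
  assumes v: "profile n m lev a A \<xi> v" and \<xi>: "\<xi> \<in> Omega m" and i: "i \<le> m" and s: "s \<in> zone \<xi> i"
  shows "lev i < v s" and "i < m \<Longrightarrow> v s < lev (Suc i)"
proof -
  have ai: "0 < a i" using a i by simp
  have "Gxi n (a i) \<xi> i < G n (s / a i)"
    using s ai i by (auto simp: zone_def Gxi_def intro!: G_pos G_strict_antimono divide_strict_right_mono)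
  then show "lev i < v s"
    using profile_zone[OF v i s] amp_pos[OF \<xi>, of i] by simp
  assume im: "i < m"
  have "G n (s / a i) < Gxi n (a i) \<xi> (Suc i)"
    using s ai im Omega_pos[OF \<xi>, of "Suc i"]
    by (auto simp: zone_def Gxi_def intro!: G_strict_antimono divide_strict_right_mono)
  then have "amp \<xi> i * (G n (s / a i) - Gxi n (a i) \<xi> i) < amp \<xi> i * gap \<xi> i"
    using amp_pos[OF \<xi>, of i] by (intro mult_strict_left_mono) (auto simp: gap_def)
  also have "\<dots> = lev (Suc i) - lev i"
    using gap_pos[OF \<xi> im] im by (simp add: amp_def)
  finally show "v s < lev (Suc i)"
    using profile_zone[OF v i s] by simp
qed

text \<open>By self-similarity and radial symmetry one point of the surface suffices: time 1, along
  an arbitrary unit vector \<open>e\<close>. The condition holds for every admissible normal, so it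
  is tested on the explicit one.\<close>

lemma stefan_solution_imp_balance_zero:
  fixes u :: "real \<Rightarrow> real^'n \<Rightarrow> real"
  assumes card: "n = CARD('n)" and u: "self_similar_solution m lev a k d A \<xi> u" and i: "i \<in> {1..m}"
  shows "balance \<xi> i = 0"
proof -
  have \<xi>: "\<xi> \<in> Omega m" using u by (simp add: self_similar_solution_def)
  obtain v where v: "profile n m lev a A \<xi> v"
    and uv: "\<And>t x. 0 < t \<Longrightarrow> x \<noteq> 0 \<Longrightarrow> u t x = v (norm x / sqrt t)"
    using u card by (auto simp: self_similar_solution_def)
  have interface: "interface lev u i = {(t, x). 0 < t \<and> norm x = \<xi> i * sqrt t}"
    using u i by (simp add: self_similar_solution_def)
  have stefan: "stefan_condition m lev k d u i"
    using u i by (simp add: self_similar_solution_def stefan_solution_def)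
  have im: "i \<le> m" "i - 1 < m" "i - 1 \<le> m" "Suc (i - 1) = i" using i by auto
  have xi: "0 < \<xi> i" using Omega_pos[OF \<xi>] i by simp
  have v_xi: "v (\<xi> i) = lev i" using v i by (simp add: profile_def)
  obtain e :: "real^'n" where e: "norm e = 1"
    using norm_axis_1 by blast
  then have e0: "e \<noteq> 0" by auto
  have below: "i < m \<Longrightarrow> \<xi> (Suc i) < \<xi> i" and above: "1 < i \<Longrightarrow> \<xi> i < \<xi> (i - 1)"
    using i Omega_less[OF \<xi>, of i "Suc i"] Omega_less[OF \<xi>, of "i - 1" i] by auto
  \<comment> \<open>A neighbourhood of \<open>\<xi> i\<close> that meets no other phase surface:
    there the side of \<open>\<xi> i\<close> alone decides the phase.\<close>
  define W0 where "W0 = zone \<xi> i \<union> {\<xi> i} \<union> zone \<xi> (i - 1)"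
  have W0_eq: "W0 = {s. 0 < s \<and> (i < m \<longrightarrow> \<xi> (Suc i) < s) \<and> (1 < i \<longrightarrow> s < \<xi> (i - 1))}"
    using xi i im below above by (auto simp: W0_def zone_def)
  have "open W0"
  proof -
    have "W0 = {0<..} \<inter> (if i < m then {\<xi> (Suc i)<..} else UNIV) \<inter> (if 1 < i then {..<\<xi> (i - 1)} else UNIV)"
      by (auto simp: W0_eq)
    then show ?thesis by (simp only:) (simp add: open_Int)
  qed
  have phases: "(t, x) \<in> phase m lev u i \<longleftrightarrow> norm x / sqrt t < \<xi> i"
    "(t, x) \<in> phase m lev u (i - 1) \<longleftrightarrow> \<xi> i < norm x / sqrt t"
    if tx: "0 < t" "x \<noteq> 0" "norm x / sqrt t \<in> W0" for t x
  proof -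
    consider "norm x / sqrt t \<in> zone \<xi> i" | "norm x / sqrt t = \<xi> i" | "norm x / sqrt t \<in> zone \<xi> (i - 1)"
      using tx(3) by (auto simp: W0_def)
    then have "((t, x) \<in> phase m lev u i \<longleftrightarrow> norm x / sqrt t < \<xi> i) \<and>
      ((t, x) \<in> phase m lev u (i - 1) \<longleftrightarrow> \<xi> i < norm x / sqrt t)"
    proof cases
      case 1
      then show ?thesis
        using profile_zone_bounds[OF v \<xi> im(1) 1] uv[OF tx(1,2)] tx(1,2) i im
        by (auto simp: phase_def zone_def)
    next
      case 2
      then show ?thesis
        using v_xi uv[OF tx(1,2)] tx(1,2) im by (auto simp: phase_def)
    next
      case 3
      then show ?thesis
        using profile_zone_bounds[OF v \<xi> im(3) 3] uv[OF tx(1,2)] tx(1,2) i im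
        by (auto simp: phase_def zone_def)
    qed
    then show "(t, x) \<in> phase m lev u i \<longleftrightarrow> norm x / sqrt t < \<xi> i"
      "(t, x) \<in> phase m lev u (i - 1) \<longleftrightarrow> \<xi> i < norm x / sqrt t" by auto
  qed
  define P where "P = (1 :: real, \<xi> i *\<^sub>R e)"
  have "P \<in> interface lev u i"
    using xi e by (simp add: interface P_def)
  then obtain pplus pminus where p: "grad_limit u (phase m lev u i) P pplus"
    "grad_limit u (phase m lev u (i - 1)) P pminus"
    and flux_jump: "\<And>\<nu>t \<nu>x. normal_from_to (interface lev u i) (phase m lev u (i - 1)) (phase m lev u i) P (\<nu>t, \<nu>x)
        \<Longrightarrow> - d i * \<nu>t + (k i *\<^sub>R pplus - k (i - 1) *\<^sub>R pminus) \<bullet> \<nu>x = 0"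
    using stefan unfolding stefan_condition_def by metis
  \<comment> \<open>The derivative formula of phase \<open>j\<close>, used on both sides of
    \<open>\<xi> i\<close>, so that a one-sided limit is its value at
    \<open>\<xi> i\<close>.\<close>
  define slope where "slope j r = - amp \<xi> j * ker n (r / a j) / a j" for j r
  have slope: "((\<lambda>r. u 1 (r *\<^sub>R e)) has_real_derivative slope j r) (at r)" if "j \<le> m" "r \<in> zone \<xi> j" for j r
  proof (rule has_field_derivative_transform_within_open[OF _ open_zone that(2)])
    have "0 < r" "0 < a j" using that a by (auto simp: zone_def)
    then have G: "((\<lambda>r. G n (r / a j)) has_real_derivative - ker n (r / a j) * (1 / a j)) (at r)"
      by (intro DERIV_G_chain) (auto intro!: derivative_eq_intros)
    show "((\<lambda>s. lev j + amp \<xi> j * (G n (s / a j) - Gxi n (a j) \<xi> j)) has_real_derivative slope j r) (at r)"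
      by (rule DERIV_cong[OF DERIV_add[OF DERIV_const DERIV_cmult[OF DERIV_diff[OF G DERIV_const]]]])
         (simp add: slope_def)
    fix s assume s: "s \<in> zone \<xi> j"
    then have "0 < s" by (simp add: zone_def)
    then show "lev j + amp \<xi> j * (G n (s / a j) - Gxi n (a j) \<xi> j) = u 1 (s *\<^sub>R e)"
      using uv[of 1 "s *\<^sub>R e"] e e0 profile_zone[OF v that(1) s] by simp
  qed
  have slope_lim: "(slope j \<longlongrightarrow> slope j (\<xi> i)) (at (\<xi> i))" if "j \<le> m" for j
  proof -
    have "isCont (ker n) (\<xi> i / a j)"
      using xi a[OF that] by (intro DERIV_isCont[OF DERIV_ker]) simp
    then have "((\<lambda>r. ker n (r / a j)) \<longlongrightarrow> ker n (\<xi> i / a j)) (at (\<xi> i))"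
      using a[OF that] by (intro isCont_tendsto_compose[of _ "ker n"] tendsto_intros) auto
    then show ?thesis
      unfolding slope_def using a[OF that] by (intro tendsto_intros) auto
  qed
  have slope_flux: "k j * slope j (\<xi> i) = - (flux \<xi> j i / \<xi> i)" if "j \<le> m" for j
    using i xi by (simp add: slope_def flux_def)
  have left: "\<forall>\<^sub>F r in at_left (\<xi> i). r \<in> zone \<xi> i"
    using xi below i
    by (intro eventually_at_leftI[of "max 0 (if i < m then \<xi> (Suc i) else 0)"]) (auto simp: zone_def split: if_splits)
  have right: "\<forall>\<^sub>F r in at_right (\<xi> i). r \<in> zone \<xi> (i - 1)"
    using xi above i
    by (intro eventually_at_rightI[of _ "if 1 < i then \<xi> (i - 1) else \<xi> i + 1"]) (auto simp: zone_def)
  have radial: "norm (r *\<^sub>R e) / sqrt 1 = r \<and> r *\<^sub>R e \<noteq> 0" if "0 < r" for r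
    using that e e0 by simp
  \<comment> \<open>The warmer phase \<open>i\<close> lies at smaller radii, so its gradient limit
    is a left derivative.\<close>
  have plus: "pplus \<bullet> e = slope i (\<xi> i)"
  proof (rule grad_limit_radial[OF p(1)[unfolded P_def] e])
    show "\<forall>\<^sub>F r in at_left (\<xi> i). (1, r *\<^sub>R e) \<in> phase m lev u i"
      using left
    proof eventually_elim
      case (elim r)
      then show ?case
        using phases(1)[of 1 "r *\<^sub>R e"] radial[of r] i by (auto simp: W0_def zone_def)
    qed
    show "\<forall>\<^sub>F r in at_left (\<xi> i). ((\<lambda>r. u 1 (r *\<^sub>R e)) has_real_derivative slope i r) (at r)"
      using left by eventually_elim (rule slope[OF im(1)])
    show "(slope i \<longlongrightarrow> slope i (\<xi> i)) (at_left (\<xi> i))"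
      by (rule tendsto_mono[OF at_le slope_lim[OF im(1)]]) simp
  qed (auto intro: at_le)
  have minus: "pminus \<bullet> e = slope (i - 1) (\<xi> i)"
  proof (rule grad_limit_radial[OF p(2)[unfolded P_def] e])
    show "\<forall>\<^sub>F r in at_right (\<xi> i). (1, r *\<^sub>R e) \<in> phase m lev u (i - 1)"
      using right
    proof eventually_elim
      case (elim r)
      then show ?case
        using phases(2)[of 1 "r *\<^sub>R e"] radial[of r] i im by (auto simp: W0_def zone_def)
    qed
    show "\<forall>\<^sub>F r in at_right (\<xi> i). ((\<lambda>r. u 1 (r *\<^sub>R e)) has_real_derivative slope (i - 1) r) (at r)"
      using right by eventually_elim (rule slope[OF im(3)])
    show "(slope (i - 1) \<longlongrightarrow> slope (i - 1) (\<xi> i)) (at_right (\<xi> i))"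
      by (rule tendsto_mono[OF at_le slope_lim[OF im(3)]]) simp
  qed (auto intro: at_le)
  define H where "H = {P :: real \<times> (real^'n). 0 < fst P \<and> snd P \<noteq> 0}"
  define W where "W = H \<inter> (\<lambda>P. norm (snd P) / sqrt (fst P)) -` W0"
  have "open H"
  proof -
    have "H = {0<..} \<times> - {0}" by (auto simp: H_def)
    then show ?thesis by (simp add: open_Times open_Compl)
  qed
  moreover have "continuous_on H (\<lambda>P. norm (snd P) / sqrt (fst P))"
    by (intro continuous_intros) (auto simp: H_def)
  ultimately have "open W"
    unfolding W_def using \<open>open W0\<close> by (intro continuous_open_preimage)
  have "normal_from_to (interface lev u i) (phase m lev u (i - 1)) (phase m lev u i) P
      (\<xi> i / (2 * sqrt 1), - sgn (\<xi> i *\<^sub>R e))"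
    unfolding P_def
  proof (rule normal_parabolic_cone[OF \<open>open W\<close>])
    show "(1, \<xi> i *\<^sub>R e) \<in> W"
      using xi e e0 by (simp add: W_def H_def W0_def)
    fix s and y :: "real^'n" assume "(s, y) \<in> W"
    then have sy: "0 < s" "y \<noteq> 0" "norm y / sqrt s \<in> W0" by (auto simp: W_def H_def)
    then show "0 < s \<and> y \<noteq> 0" by simp
    show "(s, y) \<in> interface lev u i \<longleftrightarrow> norm y = \<xi> i * sqrt s"
      using sy by (simp add: interface)
    show "(s, y) \<in> phase m lev u (i - 1) \<longleftrightarrow> \<xi> i * sqrt s < norm y"
      using phases(2)[OF sy] sy by (simp add: field_simps)
    show "(s, y) \<in> phase m lev u i \<longleftrightarrow> norm y < \<xi> i * sqrt s"
      using phases(1)[OF sy] sy by (simp add: field_simps)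
  qed (use e xi in simp)
  moreover have "sgn (\<xi> i *\<^sub>R e) = e"
    using e xi by (simp add: sgn_div_norm)
  ultimately have "- d i * (\<xi> i / 2) + (k i *\<^sub>R pplus - k (i - 1) *\<^sub>R pminus) \<bullet> (- e) = 0"
    using flux_jump[of "\<xi> i / 2" "- e"] by simp
  then have "d i * (\<xi> i / 2) + k i * slope i (\<xi> i) - k (i - 1) * slope (i - 1) (\<xi> i) = 0"
    by (simp add: inner_diff_left plus minus)
  then have "d i * (\<xi> i / 2) - flux \<xi> i i / \<xi> i + flux \<xi> (i - 1) i / \<xi> i = 0"
    using slope_flux[OF im(1)] slope_flux[OF im(3)] by simp
  then have "\<xi> i * (d i * (\<xi> i / 2) - flux \<xi> i i / \<xi> i + flux \<xi> (i - 1) i / \<xi> i) = 0"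
    by simp
  then show ?thesis
    using xi by (simp add: balance_def algebra_simps power2_eq_square)
qed

end

section \<open>Uniqueness of the radii; the only critical point is the minimizer\<close>

theorem theorem2p3:
  fixes m :: nat and lev a k d :: "nat \<Rightarrow> real" and A :: real
  assumes "CARD('n::finite) \<ge> 2" and "m \<ge> 1"
    and "\<And>i. i < m \<Longrightarrow> lev i < lev (Suc i)"
    and "\<And>i. i \<le> m \<Longrightarrow> a i > 0"
    and "\<And>i. i \<le> m \<Longrightarrow> k i > 0"
    and "\<And>i. 1 \<le> i \<Longrightarrow> i \<le> m \<Longrightarrow> d i \<ge> 0"
    and "A > 0"
  shows "(\<exists>\<^sub>\<le>\<^sub>1 \<xi>. \<exists>u :: real \<Rightarrow> real^'n \<Rightarrow> real. self_similar_solution m lev a k d A \<xi> u) \<and>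
         (\<exists>\<xi>. {\<eta> \<in> Omega m. critical_point m (E CARD('n) m lev a k d A) \<eta>} = {\<xi>} \<and>
              {\<eta>. is_arg_min (E CARD('n) m lev a k d A) (\<lambda>\<zeta>. \<zeta> \<in> Omega m) \<eta>} = {\<xi>})"
proof -
  interpret stefan "CARD('n)" m lev a k d A
    using assms by unfold_locales auto
  obtain \<xi> where \<xi>: "\<xi> \<in> Omega m" "\<And>\<eta>. \<eta> \<in> Omega m \<Longrightarrow> energy \<xi> \<le> energy \<eta>"
    using energy_attains_min by blast
  have balance: "balance \<xi> i = 0" if "i \<in> {1..m}" for i
    using min_imp_balance_zero[OF \<xi> that] .
  \<comment> \<open>The minimizer is the common point of comparison: another tuple with zero balance
    would lie strictly below it.\<close>
  have unique: "\<eta> = \<xi>" if "\<eta> \<in> Omega m" "\<And>i. i \<in> {1..m} \<Longrightarrow> balance \<eta> i = 0" for \<eta>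
    using balance_zero_imp_strict_min[OF that \<xi>(1)] \<xi>(2)[OF that(1)] by force
  have "\<eta> = \<xi>" if "self_similar_solution m lev a k d A \<eta> (u :: real \<Rightarrow> real^'n \<Rightarrow> real)" for \<eta> u
    using unique[of \<eta>] stefan_solution_imp_balance_zero[OF refl that] that
    by (auto simp: self_similar_solution_def)
  then have "\<exists>\<^sub>\<le>\<^sub>1 \<xi>. \<exists>u :: real \<Rightarrow> real^'n \<Rightarrow> real. self_similar_solution m lev a k d A \<xi> u"
    by (auto intro!: Uniq_I)
  moreover have "{\<eta> \<in> Omega m. critical_point m energy \<eta>} = {\<xi>}"
  proof -
    have "\<eta> \<in> Omega m \<and> critical_point m energy \<eta> \<longleftrightarrow> \<eta> = \<xi>" for \<eta>
      using unique[of \<eta>] balance \<xi>(1) critical_point_iff_balance[of \<eta>] by auto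
    then show ?thesis by blast
  qed
  moreover have "{\<eta>. is_arg_min energy (\<lambda>\<zeta>. \<zeta> \<in> Omega m) \<eta>} = {\<xi>}"
  proof -
    have "is_arg_min energy (\<lambda>\<zeta>. \<zeta> \<in> Omega m) \<eta> \<longleftrightarrow> \<eta> = \<xi>" for \<eta>
      using \<xi> balance_zero_imp_strict_min[OF \<xi>(1) balance, of \<eta>]
      unfolding is_arg_min_def by (metis not_less)
    then show ?thesis by blast
  qed
  ultimately show ?thesis by blast
qed

end
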